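(* Assume that $F=\frac1n\sum_{i=1}^nf_i$ is $\mu$-strongly convex, and that each $f_i$ is convex with $f_i\in C_L^1(\mathbb R^d)$. Let $\alpha>2$ be any constant, let $k_0:=\alpha\cdot\kappa$, and consider the step sizes $\eta_i^1=\frac{2\alpha/\mu}{k_0+i}$ for $i\in[n]$, and $\eta_i^k=\frac{2\alpha/\mu}{k_0+nk}$ for $k\in\{2,\dots,K\}$ and $i\in[n]$. Assume that the bounded iterates assumption holds. Then, for any $K\ge1$, RandomShuffle with step sizes $\eta_i^k$ and initialization $\boldsymbol x_0$ satisfies, for some $c_1=O(\kappa^4)$ and $c_2=O(\kappa^\alpha)$, $$\mathbb E\big[F(\boldsymbol x_0^{K+1})\big]-F^*\;\le\;\frac{c_1\cdot n}{(k_0+nK)^2}+\frac{c_2\cdot\|\boldsymbol x_0-\boldsymbol x^*\|^2}{(k_0+nK)^\alpha}.$$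
   Context: Setting: $n\ge2$ and $d\ge1$ are integers, $f_1,\dots,f_n:\mathbb R^d\to\mathbb R$ are differentiable, $F:=\frac1n\sum_{i=1}^n f_i$, $[a]:=\{1,\dots,a\}$, $\|\cdot\|$ is the Euclidean norm, $L,\mu>0$, $\kappa:=L/\mu$, $\boldsymbol x^*$ is the minimizer of $F$ and $F^*=F(\boldsymbol x^* )$. $C_L^1(\mathbb R^d)$ is the class of differentiable functions $h$ on $\mathbb R^d$ that are $L$-smooth: $h(\boldsymbol y)\le h(\boldsymbol x)+\langle\nabla h(\boldsymbol x),\boldsymbol y-\boldsymbol x\rangle+\frac L2\|\boldsymbol y-\boldsymbol x\|^2$ for all $\boldsymbol x,\boldsymbol y$. $F$ is $\mu$-strongly convex if $F(\boldsymbol y)\ge F(\boldsymbol x)+\langle\nabla F(\boldsymbol x),\boldsymbol y-\boldsymbol x\rangle+\frac\mu2\|\boldsymbol y-\boldsymbol x\|^2$ for all $\boldsymbol x,\boldsymbol y$. RandomShuffle: set $\boldsymbol x_0^1:=\boldsymbol x_0$. In each epoch $k=1,2,\dots$ draw a permutation $\sigma_k$ of $[n]$ uniformly at random, independently across epochs, and for $i=1,\dots,n$ set $\boldsymbol x_i^k:=\boldsymbol x_{i-1}^k-\eta_i^k\nabla f_{\sigma_k(i)}(\boldsymbol x_{i-1}^k)$; then set $\boldsymbol x_0^{k+1}:=\boldsymbol x_n^k$. The expectation is over the random permutations. Bounded iterates assumption: all the iterates $\{\boldsymbol x_1^k,\dots,\boldsymbol x_n^k\}_{k\ge1}$ are uniformly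 bounded, i.e. stay within some compact set $S\subset\mathbb R^d$ (for every realization of the permutations). Meaning of the $O$-notation: let $G$ be the maximum of $\|\nabla f_i\|$, $i\in[n]$, over the convex hull of $S\cup\{\boldsymbol x_0\}$. The paper uses the convention $\kappa=\Theta(1/\mu)$, so $L$, $G$ and $\alpha$ are treated as constants: $c_j=O(\kappa^p)$ means $c_j\le C\kappa^p$ where $C$ depends only on $L$, $G$ and $\alpha$ (not on $\mu,n,K,d$). *)

theory Defs
  imports "HOL-Analysis.Analysis" "HOL-Probability.Probability"
begin

section \<open>Euclidean spaces of all finite dimensions inside one type\<close>

text \<open>
  The constants hidden in the O-notation must not depend on the dimension \<open>d\<close>, so \<open>d\<close> has to
  be quantified inside a formula and cannot be a type.  All spaces \<open>\<real>\<^sup>d\<close> are therefore realised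
  as the subspaces \<open>Rd d\<close> of the inner product space of finitely supported real sequences.  In this
  way inner product, norm, compactness, convexity, convex hulls and derivatives are those of the
  library.  Functions on \<open>\<real>\<^sup>d\<close> are total functions on that type of which only the restriction
  to \<open>Rd d\<close> is ever used.
\<close>

typedef fsvec = "{x :: nat \<Rightarrow> real. finite {i. x i \<noteq> 0}}"
  morphisms coord Abs_fsvec
  by (rule exI[of _ "\<lambda>_. 0"]) simp

lemma finite_coord [simp]: "finite {i. coord x i \<noteq> 0}"
  using coord[of x] by simp

lemma fsvec_eqI: "(\<And>i. coord x i = coord y i) \<Longrightarrow> x = y"
  by (simp add: coord_inject[symmetric] fun_eq_iff)

lemma coord_Abs: "finite {i. x i \<noteq> 0} \<Longrightarrow> coord (Abs_fsvec x) = x"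
  by (simp add: Abs_fsvec_inverse)

instantiation fsvec :: real_vector
begin

definition zero_fsvec :: fsvec where "0 = Abs_fsvec (\<lambda>_. 0)"
definition plus_fsvec :: "fsvec \<Rightarrow> fsvec \<Rightarrow> fsvec"
  where "x + y = Abs_fsvec (\<lambda>i. coord x i + coord y i)"
definition minus_fsvec :: "fsvec \<Rightarrow> fsvec \<Rightarrow> fsvec"
  where "x - y = Abs_fsvec (\<lambda>i. coord x i - coord y i)"
definition uminus_fsvec :: "fsvec \<Rightarrow> fsvec"
  where "- x = Abs_fsvec (\<lambda>i. - coord x i)"
definition scaleR_fsvec :: "real \<Rightarrow> fsvec \<Rightarrow> fsvec"
  where "r *\<^sub>R x = Abs_fsvec (\<lambda>i. r * coord x i)"
lemma coord_zero: "coord 0 i = 0"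
  by (simp add: zero_fsvec_def coord_Abs)

lemma coord_add: "coord (x + y) i = coord x i + coord y i"
proof -
  have "finite {i. coord x i + coord y i \<noteq> 0}"
    by (rule finite_subset[of _ "{i. coord x i \<noteq> 0} \<union> {i. coord y i \<noteq> 0}"]) auto
  then show ?thesis by (simp add: plus_fsvec_def coord_Abs)
qed

lemma coord_diff: "coord (x - y) i = coord x i - coord y i"
proof -
  have "finite {i. coord x i - coord y i \<noteq> 0}"
    by (rule finite_subset[of _ "{i. coord x i \<noteq> 0} \<union> {i. coord y i \<noteq> 0}"]) auto
  then show ?thesis by (simp add: minus_fsvec_def coord_Abs)
qed

lemma coord_uminus: "coord (- x) i = - coord x i"
  by (simp add: uminus_fsvec_def coord_Abs)

lemma coord_scaleR: "coord (r *\<^sub>R x) i = r * coord x i"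
proof -
  have "finite {i. r * coord x i \<noteq> 0}"
    by (rule finite_subset[of _ "{i. coord x i \<noteq> 0}"]) auto
  then show ?thesis by (simp add: scaleR_fsvec_def coord_Abs)
qed

instance
proof
  fix x y z :: fsvec and a b :: real
  show "x + y + z = x + (y + z)" "x + y = y + x" "0 + x = x" "- x + x = 0" "x - y = x + - y"
       "a *\<^sub>R (x + y) = a *\<^sub>R x + a *\<^sub>R y" "(a + b) *\<^sub>R x = a *\<^sub>R x + b *\<^sub>R x"
       "a *\<^sub>R b *\<^sub>R x = (a * b) *\<^sub>R x" "1 *\<^sub>R x = x"
    by (rule fsvec_eqI;
        simp add: coord_zero coord_add coord_diff coord_uminus coord_scaleR algebra_simps)+
qed

end

instantiation fsvec :: real_inner
begin

definition inner_fsvec :: "fsvec \<Rightarrow> fsvec \<Rightarrow> real"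
  where "inner x y = (\<Sum>i | coord x i \<noteq> 0. coord x i * coord y i)"
definition norm_fsvec :: "fsvec \<Rightarrow> real"
  where "norm (x :: fsvec) = sqrt (x \<bullet> x)"
definition sgn_fsvec :: "fsvec \<Rightarrow> fsvec"
  where "sgn (x :: fsvec) = x /\<^sub>R norm x"
definition dist_fsvec :: "fsvec \<Rightarrow> fsvec \<Rightarrow> real"
  where "dist x y = norm (x - y :: fsvec)"
definition uniformity_fsvec :: "(fsvec \<times> fsvec) filter"
  where "uniformity = (INF e\<in>{0<..}. principal {(x :: fsvec, y). dist x y < e})"
definition open_fsvec :: "fsvec set \<Rightarrow> bool"
  where "open (U :: fsvec set) \<longleftrightarrow> (\<forall>x\<in>U. eventually (\<lambda>(x', y). x' = x \<longrightarrow> y \<in> U) uniformity)"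

lemma inner_fsvec_superset:
  assumes "finite A" "\<And>i. coord x i \<noteq> 0 \<Longrightarrow> coord y i \<noteq> 0 \<Longrightarrow> i \<in> A"
  shows "x \<bullet> y = (\<Sum>i\<in>A. coord x i * coord y i)"
proof -
  have "x \<bullet> y = (\<Sum>i\<in>A \<union> {i. coord x i \<noteq> 0}. coord x i * coord y i)"
    unfolding inner_fsvec_def using assms(1) by (intro sum.mono_neutral_left) auto
  also have "\<dots> = (\<Sum>i\<in>A. coord x i * coord y i)"
    using assms by (intro sum.mono_neutral_right) auto
  finally show ?thesis .
qed

instance
proof
  fix x y z :: fsvec and a :: real and U :: "fsvec set"
  show "sgn x = x /\<^sub>R norm x" by (rule sgn_fsvec_def)
  show "dist x y = norm (x - y)" by (rule dist_fsvec_def)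
  show "uniformity = (INF e\<in>{0<..}. principal {(x :: fsvec, y). dist x y < e})"
    by (rule uniformity_fsvec_def)
  show "open U \<longleftrightarrow> (\<forall>x\<in>U. eventually (\<lambda>(x', y). x' = x \<longrightarrow> y \<in> U) uniformity)"
    by (rule open_fsvec_def)
  show "norm x = sqrt (x \<bullet> x)" by (rule norm_fsvec_def)
  let ?A = "{i. coord x i \<noteq> 0} \<union> {i. coord y i \<noteq> 0}"
  have *: "u \<bullet> z = (\<Sum>i\<in>?A. coord u i * coord z i)" if "u \<in> {x, y, x + y}" for u
    using that by (intro inner_fsvec_superset) (auto simp: coord_add)
  show "(x + y) \<bullet> z = x \<bullet> z + y \<bullet> z"
    by (simp add: * coord_add distrib_right sum.distrib)
  show "x \<bullet> y = y \<bullet> x"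
    by (simp add: inner_fsvec_superset[of ?A] mult.commute)
  have "(a *\<^sub>R x) \<bullet> y = (\<Sum>i | coord x i \<noteq> 0. coord (a *\<^sub>R x) i * coord y i)"
    by (rule inner_fsvec_superset) (auto simp: coord_scaleR)
  then show "(a *\<^sub>R x) \<bullet> y = a * (x \<bullet> y)"
    by (simp add: inner_fsvec_def coord_scaleR sum_distrib_left mult.assoc)
  show "0 \<le> x \<bullet> x" by (simp add: inner_fsvec_def sum_nonneg)
  show "x \<bullet> x = 0 \<longleftrightarrow> x = 0"
  proof
    assume "x \<bullet> x = 0"
    then have "\<forall>i\<in>{i. coord x i \<noteq> 0}. coord x i * coord x i = 0"
      by (simp add: inner_fsvec_def sum_nonneg_eq_0_iff)
    then show "x = 0" by (auto intro!: fsvec_eqI simp: coord_zero)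
  qed (simp add: inner_fsvec_def coord_zero)
qed

end

definition Rd :: "nat \<Rightarrow> fsvec set"
  where "Rd d = {x. \<forall>i\<ge>d. coord x i = 0}"

lemma subspace_Rd: "subspace (Rd d)"
  by (auto simp: subspace_def Rd_def coord_zero coord_add coord_scaleR)

lemma inner_Rd: "x \<in> Rd d \<Longrightarrow> x \<bullet> y = (\<Sum>i<d. coord x i * coord y i)"
  by (rule inner_fsvec_superset) (auto simp: Rd_def not_less[symmetric])

lemma norm_Rd: "x \<in> Rd d \<Longrightarrow> norm x = sqrt (\<Sum>i<d. (coord x i)\<^sup>2)"
  by (simp add: norm_eq_sqrt_inner inner_Rd power2_eq_square)

lemma coord_sum: "coord (sum g A) i = (\<Sum>a\<in>A. coord (g a) i)"
  by (induction A rule: infinite_finite_induct) (auto simp: coord_zero coord_add)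

text \<open>\<open>Rd d\<close> is linearly isometric to every \<open>d\<close>-dimensional Euclidean space.\<close>

lemma Rd_isometry:
  obtains \<phi> :: "'a :: euclidean_space \<Rightarrow> fsvec"
  where "linear \<phi>" "\<phi> ` UNIV = Rd DIM('a)" "\<And>x y. \<phi> x \<bullet> \<phi> y = x \<bullet> y"
proof -
  obtain e where e: "bij_betw e {0..<DIM('a)} (Basis :: 'a set)"
    using ex_bij_betw_nat_finite[OF finite_Basis] by blast
  have e': "bij_betw e {..<DIM('a)} (Basis :: 'a set)"
    using e by (simp add: atLeast0LessThan)
  define \<phi> where "\<phi> x = Abs_fsvec (\<lambda>i. if i < DIM('a) then x \<bullet> e i else 0)" for x :: 'a
  have co: "coord (\<phi> x) i = (if i < DIM('a) then x \<bullet> e i else 0)" for x i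
    unfolding \<phi>_def by (subst coord_Abs) (auto intro: finite_subset[of _ "{..<DIM('a)}"])
  have Rd: "\<phi> x \<in> Rd DIM('a)" for x by (simp add: Rd_def co)
  show thesis
  proof
    show "linear \<phi>"
      by (rule linearI) (auto intro!: fsvec_eqI simp: co coord_add coord_scaleR inner_add_left)
    show "\<phi> x \<bullet> \<phi> y = x \<bullet> y" for x y
    proof -
      have "\<phi> x \<bullet> \<phi> y = (\<Sum>i<DIM('a). (x \<bullet> e i) * (y \<bullet> e i))"
        by (simp add: inner_Rd[OF Rd] co)
      also have "\<dots> = (\<Sum>b\<in>Basis. (x \<bullet> b) * (y \<bullet> b))"
        by (rule sum.reindex_bij_betw[OF e'])
      finally show ?thesis by (simp add: euclidean_inner[symmetric])
    qed
    have "z \<in> range \<phi>" if z: "z \<in> Rd DIM('a)" for z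
    proof
      let ?x = "\<Sum>i<DIM('a). coord z i *\<^sub>R e i"
      show "z = \<phi> ?x"
      proof (rule fsvec_eqI)
        fix j
        show "coord z j = coord (\<phi> ?x) j"
        proof (cases "j < DIM('a)")
          case True
          have "e i \<bullet> e j = (if i = j then 1 else 0)" if "i < DIM('a)" for i
            using that True bij_betwE[OF e'] bij_betw_imp_inj_on[OF e']
            by (auto simp: inner_Basis inj_on_eq_iff)
          then have "?x \<bullet> e j = (\<Sum>i<DIM('a). coord z i * (if i = j then 1 else 0))"
            by (simp add: inner_sum_left)
          then show ?thesis using True by (simp add: co if_distrib cong: if_cong)
        qed (use z in \<open>auto simp: Rd_def co\<close>)
      qed
    qed simp
    then show "\<phi> ` UNIV = Rd DIM('a)" using Rd by blast
  qed
qed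


section \<open>Gradients, smoothness and strong convexity\<close>

definition grad :: "nat \<Rightarrow> (fsvec \<Rightarrow> real) \<Rightarrow> fsvec \<Rightarrow> fsvec"
  where "grad d h x = (THE g. g \<in> Rd d \<and> (h has_derivative (\<lambda>v. g \<bullet> v)) (at x within Rd d))"

lemma grad_ex1:
  assumes x: "x \<in> Rd d" and h: "h differentiable (at x within Rd d)"
  shows "\<exists>!g. g \<in> Rd d \<and> (h has_derivative (\<lambda>v. g \<bullet> v)) (at x within Rd d)"
proof (rule ex_ex1I)
  define u where "u i = Abs_fsvec (\<lambda>j. if j = i then 1 else 0)" for i
  have u: "coord (u i) j = (if j = i then 1 else 0)" for i j
    unfolding u_def by (subst coord_Abs) auto
  obtain D where D: "(h has_derivative D) (at x within Rd d)"
    using h by (auto simp: differentiable_def)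
  then have lin: "linear D" using has_derivative_linear by blast
  define g where "g = Abs_fsvec (\<lambda>i. if i < d then D (u i) else 0)"
  have cg: "coord g i = (if i < d then D (u i) else 0)" for i
    unfolding g_def by (subst coord_Abs) (auto intro: finite_subset[of _ "{..<d}"])
  have g: "g \<in> Rd d" by (simp add: Rd_def cg)
  have Dg: "D v = g \<bullet> v" if v: "v \<in> Rd d" for v
  proof -
    have "v = (\<Sum>i<d. coord v i *\<^sub>R u i)"
      using v by (intro fsvec_eqI)
        (auto simp: coord_sum coord_scaleR u Rd_def if_distrib not_less cong: if_cong)
    then have "D v = D (\<Sum>i<d. coord v i *\<^sub>R u i)" by (rule arg_cong)
    also have "\<dots> = (\<Sum>i<d. coord v i * D (u i))"
      by (simp add: linear_sum[OF lin] linear_scale[OF lin])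
    also have "\<dots> = g \<bullet> v" by (simp add: inner_Rd[OF g] cg mult.commute)
    finally show ?thesis .
  qed
  have "(h has_derivative (\<lambda>v. g \<bullet> v)) (at x within Rd d)"
    using D x subspace_diff[OF subspace_Rd]
    unfolding has_derivative_within
    by (auto simp: Dg bounded_linear_inner_right cong: Lim_cong_within)
  then show "\<exists>g. g \<in> Rd d \<and> (h has_derivative (\<lambda>v. g \<bullet> v)) (at x within Rd d)"
    using g by blast
next
  fix g1 g2
  assume 1: "g1 \<in> Rd d \<and> (h has_derivative (\<lambda>v. g1 \<bullet> v)) (at x within Rd d)"
    and 2: "g2 \<in> Rd d \<and> (h has_derivative (\<lambda>v. g2 \<bullet> v)) (at x within Rd d)"
  define k where "k = g1 - g2"
  have "k \<in> Rd d" using 1 2 subspace_diff[OF subspace_Rd] by (auto simp: k_def)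
  then have img: "(\<lambda>t. x + t *\<^sub>R k) ` UNIV \<subseteq> Rd d"
    using x subspace_Rd by (auto intro: subspace_add subspace_scale)
  have line: "((\<lambda>t. h (x + t *\<^sub>R k)) has_derivative (\<lambda>t. g \<bullet> (t *\<^sub>R k))) (at 0)"
    if "(h has_derivative (\<lambda>v. g \<bullet> v)) (at x within Rd d)" for g
  proof -
    have 1: "((\<lambda>t. x + t *\<^sub>R k) has_derivative (\<lambda>t. t *\<^sub>R k)) (at 0)"
      by (auto intro!: derivative_eq_intros)
    have 2: "(h has_derivative (\<lambda>v. g \<bullet> v)) (at (x + 0 *\<^sub>R k) within (\<lambda>t. x + t *\<^sub>R k) ` UNIV)"
      using has_derivative_subset[OF that img] by simp
    show ?thesis by (rule has_derivative_in_compose[OF 1 2])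
  qed
  have "(\<lambda>t. g1 \<bullet> (t *\<^sub>R k)) = (\<lambda>t. g2 \<bullet> (t *\<^sub>R k))"
    using line 1 2 has_derivative_unique by blast
  then have "g1 \<bullet> k = g2 \<bullet> k" by (metis scaleR_one)
  then have "k \<bullet> k = 0" by (simp add: k_def inner_diff_left)
  then show "g1 = g2" by (simp add: k_def)
qed

definition C1L :: "nat \<Rightarrow> real \<Rightarrow> (fsvec \<Rightarrow> real) set"
  where "C1L d L = {h. h differentiable_on Rd d \<and>
    (\<forall>x\<in>Rd d. \<forall>y\<in>Rd d. h y \<le> h x + grad d h x \<bullet> (y - x) + L / 2 * (norm (y - x))\<^sup>2)}"

definition strongly_convex :: "nat \<Rightarrow> real \<Rightarrow> (fsvec \<Rightarrow> real) \<Rightarrow> bool"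
  where "strongly_convex d \<mu> h \<longleftrightarrow>
    (\<forall>x\<in>Rd d. \<forall>y\<in>Rd d. h y \<ge> h x + grad d h x \<bullet> (y - x) + \<mu> / 2 * (norm (y - x))\<^sup>2)"


section \<open>RandomShuffle\<close>

definition objective :: "nat \<Rightarrow> (nat \<Rightarrow> fsvec \<Rightarrow> real) \<Rightarrow> fsvec \<Rightarrow> real"
  where "objective n f x = (\<Sum>i=1..n. f i x) / real n"

text \<open>
  \<open>shuffle_iterate d n f \<eta> \<sigma> x\<^sub>0 k i\<close> is the \<open>i\<close>-th iterate of epoch \<open>k\<close> for the step sizes \<open>\<eta> k i\<close>
  and the realisation \<open>\<sigma> k\<close> of the permutations, where \<open>k \<ge> 1\<close>.  Epoch 0 is fictitious; it only
  supplies the initial point of epoch 1.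
\<close>

fun shuffle_iterate :: "nat \<Rightarrow> nat \<Rightarrow> (nat \<Rightarrow> fsvec \<Rightarrow> real) \<Rightarrow> (nat \<Rightarrow> nat \<Rightarrow> real) \<Rightarrow>
    (nat \<Rightarrow> nat \<Rightarrow> nat) \<Rightarrow> fsvec \<Rightarrow> nat \<Rightarrow> nat \<Rightarrow> fsvec" where
  "shuffle_iterate d n f \<eta> \<sigma> x\<^sub>0 0 i = x\<^sub>0"
| "shuffle_iterate d n f \<eta> \<sigma> x\<^sub>0 (Suc k) 0 = shuffle_iterate d n f \<eta> \<sigma> x\<^sub>0 k n"
| "shuffle_iterate d n f \<eta> \<sigma> x\<^sub>0 (Suc k) (Suc i) =
     (let x = shuffle_iterate d n f \<eta> \<sigma> x\<^sub>0 (Suc k) i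
      in x - \<eta> (Suc k) (Suc i) *\<^sub>R grad d (f (\<sigma> (Suc k) (Suc i))) x)"

definition random_shuffles :: "nat \<Rightarrow> nat \<Rightarrow> (nat \<Rightarrow> nat \<Rightarrow> nat) pmf"
  where "random_shuffles n K = Pi_pmf {1..K} id (\<lambda>_. pmf_of_set {\<pi>. \<pi> permutes {1..n}})"

definition bounded_iterates :: "nat \<Rightarrow> nat \<Rightarrow> (nat \<Rightarrow> fsvec \<Rightarrow> real) \<Rightarrow> (nat \<Rightarrow> nat \<Rightarrow> real) \<Rightarrow>
    fsvec \<Rightarrow> fsvec set \<Rightarrow> bool"
  where "bounded_iterates d n f \<eta> x\<^sub>0 S \<longleftrightarrow> compact S \<and> S \<subseteq> Rd d \<and>
    (\<forall>\<sigma>. (\<forall>k\<ge>1. \<sigma> k permutes {1..n}) \<longrightarrow>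
         (\<forall>k\<ge>1. \<forall>i\<in>{1..n}. shuffle_iterate d n f \<eta> \<sigma> x\<^sub>0 k i \<in> S))"

text \<open>
  The supremum is a maximum wherever it is used: the gradients of convex functions in \<open>C1L d L\<close> are
  continuous on \<open>Rd d\<close>, and the convex hull is compact.
\<close>

definition grad_bound :: "nat \<Rightarrow> nat \<Rightarrow> (nat \<Rightarrow> fsvec \<Rightarrow> real) \<Rightarrow> fsvec set \<Rightarrow> fsvec \<Rightarrow> real"
  where "grad_bound d n f S x\<^sub>0 =
    (SUP (i, x) \<in> {1..n} \<times> (convex hull (S \<union> {x\<^sub>0})). norm (grad d (f i) x))"

end

theory Submission
  imports Defs
begin

text \<open>
  Write \<open>T\<close> for the denominator of the step size, so that \<open>\<eta> L = 2 k\<^sub>0 / T\<close> and \<open>\<eta> \<mu> = 2 \<alpha> / T\<close>, and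
  \<open>Q = (G / L)\<^sup>2\<close>.  Exchanging two positions of the permutation moves an iterate by at most \<open>2 \<eta> G\<close>, as
  gradient steps with \<open>\<eta> \<le> 2 / L\<close> are nonexpansive; this allows to replace the sampled component by
  an independent one.

  While \<open>T < 64 k\<^sub>0\<close>, the squared distance to the optimum \<open>x\<^sup>*\<close> grows by at most \<open>20 Q\<close> per step, and no
  contraction is needed because \<open>(k\<^sub>0 / T)\<^sup>\<alpha>\<close> is bounded below.  Afterwards one follows
  \<open>u = x - x\<^sup>* + w\<close>, where \<open>w\<close> is the accumulated noise of the components at \<open>x\<^sup>*\<close>.  Sampling without
  replacement makes these noise terms negatively correlated, so after \<open>i\<close> steps \<open>w\<close> has second moment at
  most \<open>i \<eta>\<^sup>2\<close> times their variance, and with constant steps \<open>w\<close> vanishes at the end of the epoch.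
  Hence an epoch contracts by \<open>(1 - 3\<alpha> / (2T))\<^sup>n\<close> up to an error \<open>O(\<eta>\<^sup>3 n\<^sup>2)\<close>, without any restriction on
  \<open>n \<eta>\<close>.  The power \<open>\<kappa>\<^sup>4\<close> arises as \<open>\<kappa>\<^sup>3\<close> from \<open>\<eta>\<^sup>3\<close> and one factor \<open>\<kappa>\<close> from the bound \<open>4 \<kappa> G\<^sup>2\<close> for the
  variance: \<open>x\<^sup>*\<close> need not lie in the region where the gradients are bounded by \<open>G\<close>.
\<close>

section \<open>Averages over permutations\<close>

text \<open>The expectation over a uniformly random permutation of \<open>{1..n}\<close>, kept as a
  finite sum so that exchange arguments become reindexings;
  \<open>expectation_random_shuffles_Suc\<close> links it to the probability mass functions.\<close>

definition perm_avg :: "nat \<Rightarrow> ((nat \<Rightarrow> nat) \<Rightarrow> real) \<Rightarrow> real" where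
  "perm_avg n \<phi> = (\<Sum>\<pi> | \<pi> permutes {1..n}. \<phi> \<pi>) / fact n"

lemma perm_avg_mono:
  "(\<And>\<pi>. \<pi> permutes {1..n} \<Longrightarrow> \<phi> \<pi> \<le> \<psi> \<pi>) \<Longrightarrow> perm_avg n \<phi> \<le> perm_avg n \<psi>"
  by (auto simp: perm_avg_def intro!: divide_right_mono sum_mono)

lemma perm_avg_cong:
  "(\<And>\<pi>. \<pi> permutes {1..n} \<Longrightarrow> \<phi> \<pi> = \<psi> \<pi>) \<Longrightarrow> perm_avg n \<phi> = perm_avg n \<psi>"
  by (auto simp: perm_avg_def intro!: sum.cong)

lemma perm_avg_add: "perm_avg n (\<lambda>\<pi>. \<phi> \<pi> + \<psi> \<pi>) = perm_avg n \<phi> + perm_avg n \<psi>"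
  by (simp add: perm_avg_def sum.distrib add_divide_distrib)

lemma perm_avg_diff: "perm_avg n (\<lambda>\<pi>. \<phi> \<pi> - \<psi> \<pi>) = perm_avg n \<phi> - perm_avg n \<psi>"
  by (simp add: perm_avg_def sum_subtractf diff_divide_distrib)

lemma perm_avg_cmult: "perm_avg n (\<lambda>\<pi>. c * \<phi> \<pi>) = c * perm_avg n \<phi>"
  by (simp add: perm_avg_def sum_distrib_left)

lemma perm_avg_const: "perm_avg n (\<lambda>\<pi>. c) = c"
  by (simp add: perm_avg_def card_permutations)

lemma perm_avg_sum: "perm_avg n (\<lambda>\<pi>. \<Sum>a\<in>A. \<phi> a \<pi>) = (\<Sum>a\<in>A. perm_avg n (\<phi> a))"
  by (simp add: perm_avg_def sum.swap[of _ A] sum_divide_distrib)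

lemmas perm_avg_simps = perm_avg_add perm_avg_diff perm_avg_cmult perm_avg_const

lemma perm_avg_compose:
  "\<tau> permutes {1..n} \<Longrightarrow> perm_avg n (\<lambda>\<pi>. \<phi> (\<pi> \<circ> \<tau>)) = perm_avg n \<phi>"
  unfolding perm_avg_def using sum_permutations_compose_right by metis

text \<open>The independent index \<open>j\<close> is first renamed to \<open>\<pi> l\<close>, as
  \<open>\<pi>\<close> is a bijection; composing with the transposition of \<open>l\<close> and
  \<open>m\<close> then carries position \<open>l\<close> to \<open>m\<close>. An independent
  component thus becomes the sampled one, at the price of an exchange inside
  \<open>X\<close>.\<close>

lemma perm_avg_mean:
  assumes m: "m \<in> {1..n}"
  shows "perm_avg n (\<lambda>\<pi>. \<Sum>j=1..n. \<phi> j (X \<pi>)) =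
    (\<Sum>l=1..n. perm_avg n (\<lambda>\<pi>. \<phi> (\<pi> m) (X (\<pi> \<circ> Transposition.transpose l m))))"
proof -
  have "perm_avg n (\<lambda>\<pi>. \<Sum>j=1..n. \<phi> j (X \<pi>)) = perm_avg n (\<lambda>\<pi>. \<Sum>l=1..n. \<phi> (\<pi> l) (X \<pi>))"
    by (rule perm_avg_cong, rule sum.permute[unfolded comp_def]) 
  also have "\<dots> = (\<Sum>l=1..n. perm_avg n (\<lambda>\<pi>. \<phi> (\<pi> l) (X \<pi>)))"
    by (rule perm_avg_sum)
  also have "\<dots> = (\<Sum>l=1..n. perm_avg n (\<lambda>\<pi>. \<phi> (\<pi> m) (X (\<pi> \<circ> Transposition.transpose l m))))"
  proof (rule sum.cong[OF refl])
    fix l assume l: "l \<in> {1..n}"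
    show "perm_avg n (\<lambda>\<pi>. \<phi> (\<pi> l) (X \<pi>)) = perm_avg n (\<lambda>\<pi>. \<phi> (\<pi> m) (X (\<pi> \<circ> Transposition.transpose l m)))"
      using perm_avg_compose[OF permutes_swap_id[OF l m], of "\<lambda>\<pi>. \<phi> (\<pi> l) (X \<pi>)"] by simp
  qed
  finally show ?thesis .
qed

lemma perm_avg_apply:
  assumes m: "m \<in> {1..n}"
  shows "perm_avg n (\<lambda>\<pi>. \<phi> (\<pi> m)) = (\<Sum>j=1..n. \<phi> j) / real n"
proof -
  have "real n * perm_avg n (\<lambda>\<pi>. \<phi> (\<pi> m)) = (\<Sum>j=1..n. \<phi> j)"
    using perm_avg_mean[OF m, of "\<lambda>j _. \<phi> j" "\<lambda>_. ()"] by (simp add: perm_avg_const)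
  moreover have "n \<noteq> 0" using m by auto
  ultimately show ?thesis by (simp add: field_simps)
qed

text \<open>By symmetry all pairs of distinct positions have the same correlation \<open>c\<close>.
  Since the vectors sum to 0, \<open>(n - 1) * c\<close> is minus the mean squared norm.\<close>

lemma perm_avg_inner_nonpos:
  fixes v :: "nat \<Rightarrow> 'a :: real_inner"
  assumes v: "(\<Sum>j=1..n. v j) = 0" and jl: "j \<in> {1..n}" "l \<in> {1..n}" "j \<noteq> l"
  shows "perm_avg n (\<lambda>\<pi>. v (\<pi> j) \<bullet> v (\<pi> l)) \<le> 0"
proof -
  define c where "c = perm_avg n (\<lambda>\<pi>. v (\<pi> j) \<bullet> v (\<pi> l))"
  \<comment> \<open>Exchanging \<open>l\<close> and \<open>m\<close> leaves \<open>j\<close> fixed,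
    as both differ from \<open>j\<close>.\<close>
  have eq: "perm_avg n (\<lambda>\<pi>. v (\<pi> j) \<bullet> v (\<pi> m)) = c" if "m \<in> {1..n} - {j}" for m
    using perm_avg_compose[OF permutes_swap_id[of l "{1..n}" m], of "\<lambda>\<pi>. v (\<pi> j) \<bullet> v (\<pi> m)"] that jl
    by (auto simp: c_def Transposition.transpose_def)
  have "perm_avg n (\<lambda>\<pi>. v (\<pi> j) \<bullet> v (\<pi> j) + (\<Sum>m\<in>{1..n} - {j}. v (\<pi> j) \<bullet> v (\<pi> m))) = perm_avg n (\<lambda>\<pi>. 0)"
  proof (rule perm_avg_cong)
    fix \<pi> assume \<pi>: "\<pi> permutes {1..n}"
    have "v (\<pi> j) \<bullet> v (\<pi> j) + (\<Sum>m\<in>{1..n} - {j}. v (\<pi> j) \<bullet> v (\<pi> m)) = (\<Sum>m=1..n. v (\<pi> j) \<bullet> v (\<pi> m))"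
      using sum.remove[of "{1..n}" j "\<lambda>m. v (\<pi> j) \<bullet> v (\<pi> m)"] jl by simp
    also have "\<dots> = v (\<pi> j) \<bullet> (\<Sum>m=1..n. v (\<pi> m))" by (simp add: inner_sum_right)
    also have "(\<Sum>m=1..n. v (\<pi> m)) = 0" using sum.permute[OF \<pi>, of v] v by (simp add: comp_def)
    finally show "v (\<pi> j) \<bullet> v (\<pi> j) + (\<Sum>m\<in>{1..n} - {j}. v (\<pi> j) \<bullet> v (\<pi> m)) = 0" by simp
  qed
  then have "perm_avg n (\<lambda>\<pi>. v (\<pi> j) \<bullet> v (\<pi> j)) + real (n - 1) * c = 0"
    using jl by (simp add: perm_avg_simps perm_avg_sum eq)
  moreover have "perm_avg n (\<lambda>\<pi>. 0) \<le> perm_avg n (\<lambda>\<pi>. v (\<pi> j) \<bullet> v (\<pi> j))"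
    by (rule perm_avg_mono) simp
  ultimately have "real (n - 1) * c \<le> 0" by (simp add: perm_avg_const)
  moreover have "n - 1 > 0" using jl by auto
  ultimately show ?thesis unfolding c_def[symmetric] by (simp add: mult_le_0_iff)
qed

section \<open>Decoupling one epoch of SGD without replacement\<close>

lemma norm_diff_scaleR_sq:
  fixes a b :: "'a :: real_inner"
  shows "(norm (a - e *\<^sub>R b))\<^sup>2 = (norm a)\<^sup>2 - 2 * e * (b \<bullet> a) + e\<^sup>2 * (norm b)\<^sup>2"
  unfolding power2_norm_eq_inner
  by (simp add: inner_diff_left inner_diff_right inner_commute power2_eq_square)

fun sgd_iterate :: "(nat \<Rightarrow> 'a \<Rightarrow> 'a) \<Rightarrow> (nat \<Rightarrow> real) \<Rightarrow> (nat \<Rightarrow> nat) \<Rightarrow> 'a \<Rightarrow> nat \<Rightarrow> 'a :: real_vector"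
where
  "sgd_iterate g \<eta> \<pi> x 0 = x"
| "sgd_iterate g \<eta> \<pi> x (Suc i) =
    sgd_iterate g \<eta> \<pi> x i - \<eta> (Suc i) *\<^sub>R g (\<pi> (Suc i)) (sgd_iterate g \<eta> \<pi> x i)"

lemma sgd_iterate_cong:
  "(\<And>j. j \<in> {1..i} \<Longrightarrow> \<pi> j = \<pi>' j) \<Longrightarrow> sgd_iterate g \<eta> \<pi> x i = sgd_iterate g \<eta> \<pi>' x i"
  by (induction i) auto

text \<open>Noise accumulated along a permutation, with retention factors \<open>a\<close> and gains
  \<open>b\<close>. Constant steps use \<open>a = 1\<close>; the first epoch needs a late start and
  damping, hence sequences of coefficients.\<close>

fun drift :: "(nat \<Rightarrow> 'a) \<Rightarrow> (nat \<Rightarrow> real) \<Rightarrow> (nat \<Rightarrow> real) \<Rightarrow> (nat \<Rightarrow> nat) \<Rightarrow> nat \<Rightarrow> 'a :: real_vector" where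
  "drift v a b \<pi> 0 = 0"
| "drift v a b \<pi> (Suc i) = a (Suc i) *\<^sub>R drift v a b \<pi> i + b (Suc i) *\<^sub>R v (\<pi> (Suc i))"

text \<open>The drift after \<open>i\<close> steps is a nonnegative combination of noise terms at
  positions up to \<open>i\<close>, each negatively correlated with the one at the later position
  \<open>l\<close>.\<close>

lemma perm_avg_drift_inner_nonpos:
  fixes v :: "nat \<Rightarrow> 'a :: real_inner"
  assumes v: "(\<Sum>j=1..n. v j) = 0" and ab: "\<And>i. a i \<ge> 0" "\<And>i. b i \<ge> 0"
    and il: "i < l" "l \<le> n"
  shows "perm_avg n (\<lambda>\<pi>. drift v a b \<pi> i \<bullet> v (\<pi> l)) \<le> 0"
  using il
proof (induction i)
  case 0
  show ?case by (simp add: perm_avg_const)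
next
  case (Suc i)
  have 1: "perm_avg n (\<lambda>\<pi>. drift v a b \<pi> i \<bullet> v (\<pi> l)) \<le> 0" using Suc by simp
  have 2: "perm_avg n (\<lambda>\<pi>. v (\<pi> (Suc i)) \<bullet> v (\<pi> l)) \<le> 0"
    using Suc.prems by (intro perm_avg_inner_nonpos v) auto
  show ?case
    using mult_nonneg_nonpos[OF ab(1) 1, of "Suc i"] mult_nonneg_nonpos[OF ab(2) 2, of "Suc i"]
    by (simp add: inner_add_left perm_avg_simps)
qed

text \<open>In the expanded square the cross term is nonpositive on average, so the second moment
  grows no faster than under independent sampling.\<close>

lemma perm_avg_norm_drift_Suc_le:
  fixes v :: "nat \<Rightarrow> 'a :: real_inner"
  assumes v: "(\<Sum>j=1..n. v j) = 0" and ab: "\<And>i. a i \<ge> 0" "\<And>i. b i \<ge> 0" and i: "i < n"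
  shows "perm_avg n (\<lambda>\<pi>. (norm (drift v a b \<pi> (Suc i)))\<^sup>2) \<le>
    (a (Suc i))\<^sup>2 * perm_avg n (\<lambda>\<pi>. (norm (drift v a b \<pi> i))\<^sup>2) +
    (b (Suc i))\<^sup>2 * ((\<Sum>j=1..n. (norm (v j))\<^sup>2) / real n)"
proof -
  have "perm_avg n (\<lambda>\<pi>. (norm (drift v a b \<pi> (Suc i)))\<^sup>2) = perm_avg n (\<lambda>\<pi>.
      (a (Suc i))\<^sup>2 * (norm (drift v a b \<pi> i))\<^sup>2 +
      (2 * (a (Suc i) * b (Suc i))) * (drift v a b \<pi> i \<bullet> v (\<pi> (Suc i))) +
      (b (Suc i))\<^sup>2 * (norm (v (\<pi> (Suc i))))\<^sup>2)"
    by (rule perm_avg_cong)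
      (simp add: power2_norm_eq_inner inner_add_left inner_add_right inner_commute,
        simp add: power2_eq_square algebra_simps)
  also have "\<dots> = (a (Suc i))\<^sup>2 * perm_avg n (\<lambda>\<pi>. (norm (drift v a b \<pi> i))\<^sup>2) +
      (2 * (a (Suc i) * b (Suc i))) * perm_avg n (\<lambda>\<pi>. drift v a b \<pi> i \<bullet> v (\<pi> (Suc i))) +
      (b (Suc i))\<^sup>2 * perm_avg n (\<lambda>\<pi>. (norm (v (\<pi> (Suc i))))\<^sup>2)"
    by (simp only: perm_avg_simps)
  also have "perm_avg n (\<lambda>\<pi>. (norm (v (\<pi> (Suc i))))\<^sup>2) = (\<Sum>j=1..n. (norm (v j))\<^sup>2) / real n"
    using i by (intro perm_avg_apply) auto
  also have "(2 * (a (Suc i) * b (Suc i))) * perm_avg n (\<lambda>\<pi>. drift v a b \<pi> i \<bullet> v (\<pi> (Suc i))) \<le> 0"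
    using ab i by (intro mult_nonneg_nonpos perm_avg_drift_inner_nonpos v) auto
  finally show ?thesis by simp
qed

text \<open>Components enter only through inequalities on a subspace, without derivatives. Strong
  convexity of the average is kept only as quadratic growth around \<open>xs\<close>.\<close>

locale convex_finite_sum =
  fixes W :: "'a :: real_inner set" and n :: nat and h :: "nat \<Rightarrow> 'a \<Rightarrow> real"
    and g :: "nat \<Rightarrow> 'a \<Rightarrow> 'a" and L \<mu> :: real and xs :: 'a
  assumes W: "subspace W" and n: "n \<ge> 1" and L: "L > 0" and mu: "\<mu> > 0" and mu_le_L: "\<mu> \<le> L"
    and g_in: "\<And>j x. j \<in> {1..n} \<Longrightarrow> x \<in> W \<Longrightarrow> g j x \<in> W"
    and convex: "\<And>j x y. j \<in> {1..n} \<Longrightarrow> x \<in> W \<Longrightarrow> y \<in> W \<Longrightarrow> h j y \<ge> h j x + g j x \<bullet> (y - x)"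
    and smooth: "\<And>j x y. j \<in> {1..n} \<Longrightarrow> x \<in> W \<Longrightarrow> y \<in> W \<Longrightarrow>
      h j y \<le> h j x + g j x \<bullet> (y - x) + L / 2 * (norm (y - x))\<^sup>2"
    and xs: "xs \<in> W" and stationary: "(\<Sum>j=1..n. g j xs) = 0"
    and growth: "\<And>y. y \<in> W \<Longrightarrow>
      (\<Sum>j=1..n. h j y) / n \<ge> (\<Sum>j=1..n. h j xs) / n + \<mu> / 2 * (norm (y - xs))\<^sup>2"
begin

section \<open>Inequalities for convex smooth components\<close>

abbreviation bregman :: "nat \<Rightarrow> 'a \<Rightarrow> 'a \<Rightarrow> real" where
  "bregman j x y \<equiv> h j x - h j y - g j y \<bullet> (x - y)"

text \<open>The point \<open>z\<close>, one step of length \<open>1 / L\<close> along the gradient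
  difference, is used to compare the tangent at \<open>y\<close>, a lower bound, with the quadratic
  upper bound at \<open>x\<close>.\<close>

lemma grad_diff_le_bregman:
  assumes j: "j \<in> {1..n}" and x: "x \<in> W" and y: "y \<in> W"
  shows "(norm (g j x - g j y))\<^sup>2 \<le> 2 * L * bregman j x y"
proof -
  define \<Delta> where "\<Delta> = g j x - g j y"
  define z where "z = x - (1 / L) *\<^sub>R \<Delta>"
  have z: "z \<in> W" unfolding z_def \<Delta>_def
    using g_in[OF j x] g_in[OF j y] x W by (intro subspace_diff subspace_scale) auto
  have 1: "h j y + g j y \<bullet> (z - y) \<le> h j x + g j x \<bullet> (z - x) + L / 2 * (norm (z - x))\<^sup>2"
    using convex[OF j y z] smooth[OF j x z] by simp
  have 2: "z - x = - ((1 / L) *\<^sub>R \<Delta>)" by (simp add: z_def)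
  have 3: "g j y \<bullet> (z - y) = g j y \<bullet> (x - y) - (1 / L) * (g j y \<bullet> \<Delta>)"
    by (simp add: z_def inner_diff_right)
  have 4: "g j x \<bullet> (z - x) = - (1 / L) * (g j x \<bullet> \<Delta>)" by (simp add: 2)
  have 5: "(norm (z - x))\<^sup>2 = (1 / L)\<^sup>2 * (norm \<Delta>)\<^sup>2"
    by (simp add: 2 power_mult_distrib power_divide)
  have 6: "g j x \<bullet> \<Delta> = g j y \<bullet> \<Delta> + (norm \<Delta>)\<^sup>2"
    by (simp add: \<Delta>_def power2_norm_eq_inner inner_diff_left)
  have 7: "L / 2 * ((1 / L)\<^sup>2 * (norm \<Delta>)\<^sup>2) = (norm \<Delta>)\<^sup>2 / (2 * L)"
    using L by (simp add: power2_eq_square)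
  have "(norm \<Delta>)\<^sup>2 / (2 * L) \<le> bregman j x y"
    using 1 unfolding 3 4 5 6 7 by (simp add: algebra_simps add_divide_distrib)
  then show ?thesis using L unfolding \<Delta>_def by (simp add: field_simps)
qed

text \<open>Adding the previous bound to itself with \<open>x\<close> and \<open>y\<close> exchanged
  cancels the function values.\<close>

lemma cocoercive:
  assumes j: "j \<in> {1..n}" and x: "x \<in> W" and y: "y \<in> W"
  shows "(norm (g j x - g j y))\<^sup>2 \<le> L * ((g j x - g j y) \<bullet> (x - y))"
  using grad_diff_le_bregman[OF j x y] grad_diff_le_bregman[OF j y x] L
  by (simp add: norm_minus_commute inner_diff_left inner_diff_right algebra_simps)

lemma grad_lipschitz:
  assumes j: "j \<in> {1..n}" and x: "x \<in> W" and y: "y \<in> W"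
  shows "norm (g j x - g j y) \<le> L * norm (x - y)"
proof -
  have "(norm (g j x - g j y))\<^sup>2 \<le> L * (norm (g j x - g j y) * norm (x - y))"
    using L by (intro cocoercive[OF assms, THEN order_trans] mult_left_mono norm_cauchy_schwarz) auto
  then have "norm (g j x - g j y) * norm (g j x - g j y) \<le> norm (g j x - g j y) * (L * norm (x - y))"
    by (simp add: power2_eq_square mult_ac)
  then have "norm (g j x - g j y) = 0 \<or> norm (g j x - g j y) \<le> L * norm (x - y)"
    by (metis mult_le_cancel_left_pos norm_ge_zero order_le_less)
  then show ?thesis using L by auto
qed

text \<open>Cocoercivity lets the inner product absorb the quadratic term of the expanded square
  exactly up to step size \<open>2 / L\<close>.\<close>

lemma grad_step_nonexpansive:
  assumes j: "j \<in> {1..n}" and x: "x \<in> W" and y: "y \<in> W" and e: "0 \<le> e" "e \<le> 2 / L"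
  shows "norm ((x - e *\<^sub>R g j x) - (y - e *\<^sub>R g j y)) \<le> norm (x - y)"
proof -
  define \<Delta> where "\<Delta> = g j x - g j y"
  have "e * (norm \<Delta>)\<^sup>2 \<le> 2 / L * (norm \<Delta>)\<^sup>2" using e by (intro mult_right_mono) auto
  also have "\<dots> \<le> 2 / L * (L * (\<Delta> \<bullet> (x - y)))"
    unfolding \<Delta>_def using cocoercive[OF j x y] L by (intro mult_left_mono) auto
  also have "\<dots> = 2 * (\<Delta> \<bullet> (x - y))" using L by simp
  finally have "e * (e * (norm \<Delta>)\<^sup>2) \<le> e * (2 * (\<Delta> \<bullet> (x - y)))" using e by (intro mult_left_mono) auto
  moreover have "(x - e *\<^sub>R g j x) - (y - e *\<^sub>R g j y) = (x - y) - e *\<^sub>R \<Delta>"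
    by (simp add: \<Delta>_def scaleR_diff_right)
  moreover have "(norm ((x - y) - e *\<^sub>R \<Delta>))\<^sup>2 =
     (norm (x - y))\<^sup>2 - e * (2 * (\<Delta> \<bullet> (x - y))) + e * (e * (norm \<Delta>)\<^sup>2)"
    unfolding norm_diff_scaleR_sq by (simp only: power2_eq_square mult.assoc mult.left_commute[of 2 e])
  ultimately have "(norm ((x - e *\<^sub>R g j x) - (y - e *\<^sub>R g j y)))\<^sup>2 \<le> (norm (x - y))\<^sup>2"
    by (simp only:)
  then show ?thesis by (rule power2_le_imp_le) simp
qed

lemma sgd_iterate_in:
  assumes "\<pi> permutes {1..n}" "x \<in> W" "i \<le> n"
  shows "sgd_iterate g \<eta> \<pi> x i \<in> W"
  using assms(3)
proof (induction i)
  case (Suc i)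
  have "\<pi> (Suc i) \<in> {1..n}" using permutes_in_image[OF assms(1), of "Suc i"] Suc.prems by simp
  then show ?case using Suc by (auto intro!: subspace_diff subspace_scale W g_in)
qed (use assms in simp)

end

text \<open>The gradient bound ranges over all permutations and all components, not just the sampled
  ones, because exchange arguments evaluate components at iterates of other runs.\<close>

locale shuffle_epoch = convex_finite_sum +
  fixes \<eta> :: "nat \<Rightarrow> real" and x :: 'a and G :: real
  assumes x: "x \<in> W" and step: "\<And>i. i \<in> {1..n} \<Longrightarrow> 0 \<le> \<eta> i \<and> \<eta> i \<le> 2 / L"
    and grad_le: "\<And>\<pi> i j. \<pi> permutes {1..n} \<Longrightarrow> i \<le> n \<Longrightarrow> j \<in> {1..n} \<Longrightarrow>
      norm (g j (sgd_iterate g \<eta> \<pi> x i)) \<le> G"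
begin

section \<open>Exchanging two positions of the permutation\<close>

abbreviation X :: "(nat \<Rightarrow> nat) \<Rightarrow> nat \<Rightarrow> 'a" where
  "X \<pi> i \<equiv> sgd_iterate g \<eta> \<pi> x i"

lemma X_in: "\<pi> permutes {1..n} \<Longrightarrow> i \<le> n \<Longrightarrow> X \<pi> i \<in> W"
  using sgd_iterate_in x by blast

lemma G_nonneg: "G \<ge> 0"
  using order_trans[OF norm_ge_zero grad_le[OF permutes_id, of 0 1]] n by simp

lemma step_nonneg: "i \<in> {1..n} \<Longrightarrow> 0 \<le> \<eta> i"
  using step by blast

text \<open>Both runs agree before step \<open>l\<close>, separate there by at most
  \<open>\<eta> l * (G + G)\<close>, and then apply the same components up to step \<open>i\<close>.
  These common steps are nonexpansive.\<close>

lemma swapped_iterate_close: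
  assumes \<pi>: "\<pi> permutes {1..n}" and l: "1 \<le> l" "l \<le> i" and i: "i < n"
  shows "norm (X (\<pi> \<circ> Transposition.transpose l (Suc i)) i - X \<pi> i) \<le> 2 * \<eta> l * G"
proof -
  define \<pi>' where "\<pi>' = \<pi> \<circ> Transposition.transpose l (Suc i)"
  have \<pi>': "\<pi>' permutes {1..n}"
    unfolding \<pi>'_def using l i by (intro permutes_compose[OF permutes_swap_id \<pi>]) auto
  have eq: "\<pi>' m = \<pi> m" if "m \<noteq> l" "m \<noteq> Suc i" for m
    using that by (simp add: \<pi>'_def Transposition.transpose_def)
  have "norm (X \<pi>' m - X \<pi> m) \<le> 2 * \<eta> l * G" if "l \<le> m" "m \<le> i" for m
    using that
  proof (induction m rule: dec_induct)
    case base
    obtain p where p: "l = Suc p" using l by (cases l) auto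
    have same: "X \<pi>' p = X \<pi> p" using l p by (intro sgd_iterate_cong eq) auto
    have pin: "\<pi> l \<in> {1..n}" "\<pi>' l \<in> {1..n}"
      using permutes_in_image[OF \<pi>, of l] permutes_in_image[OF \<pi>', of l] l i by auto
    have "X \<pi>' l - X \<pi> l = \<eta> l *\<^sub>R (g (\<pi> l) (X \<pi> p) - g (\<pi>' l) (X \<pi> p))"
      by (simp add: p same scaleR_diff_right)
    then have "norm (X \<pi>' l - X \<pi> l) \<le> \<eta> l * norm (g (\<pi> l) (X \<pi> p) - g (\<pi>' l) (X \<pi> p))"
      using step_nonneg[of l] l i by simp
    also have "\<dots> \<le> \<eta> l * (G + G)"
    proof (intro mult_left_mono)
      show "norm (g (\<pi> l) (X \<pi> p) - g (\<pi>' l) (X \<pi> p)) \<le> G + G"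
        using grad_le[OF \<pi> _ pin(1), of p] grad_le[OF \<pi> _ pin(2), of p] p l i
        by (intro norm_triangle_ineq4[THEN order_trans] add_mono) auto
    qed (use step_nonneg[of l] l i in auto)
    finally show ?case by simp
  next
    case (step m)
    have m: "\<pi>' (Suc m) = \<pi> (Suc m)" using step by (intro eq) auto
    have "\<pi> (Suc m) \<in> {1..n}" using permutes_in_image[OF \<pi>, of "Suc m"] step i by auto
    then have "norm (X \<pi>' (Suc m) - X \<pi> (Suc m)) \<le> norm (X \<pi>' m - X \<pi> m)"
      using step i X_in[OF \<pi>, of m] X_in[OF \<pi>', of m] shuffle_epoch_axioms
      by (auto simp: m intro!: grad_step_nonexpansive step_nonneg shuffle_epoch.step[THEN conjunct2])
    then show ?case using step by simp
  qed
  from this[of i] show ?thesis using l by (simp add: \<pi>'_def)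
qed

text \<open>Compares the sampled component \<open>\<pi> (Suc i)\<close> with an independent one: conditioned on being
  already used, at position \<open>l\<close> say, the latter can be exchanged with \<open>\<pi> (Suc i)\<close> at cost \<open>d l\<close>.\<close>

lemma perm_avg_decouple:
  assumes i: "i < n"
    and base: "\<And>\<pi>. \<pi> permutes {1..n} \<Longrightarrow> \<phi> (\<pi> (Suc i)) (X \<pi> i) \<le> \<psi> \<pi>"
    and swap: "\<And>\<pi> y l. \<pi> permutes {1..n} \<Longrightarrow> l \<in> {1..i} \<Longrightarrow> y \<in> W \<Longrightarrow>
      (\<forall>j\<in>{1..n}. norm (g j y) \<le> G) \<Longrightarrow>
      norm (y - X \<pi> i) \<le> 2 * \<eta> l * G \<Longrightarrow> \<phi> (\<pi> (Suc i)) y \<le> \<psi> \<pi> + d l"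
  shows "perm_avg n (\<lambda>\<pi>. (\<Sum>j=1..n. \<phi> j (X \<pi> i)) / real n) \<le> perm_avg n \<psi> + (\<Sum>l=1..i. d l) / real n"
proof -
  have exchange: "perm_avg n (\<lambda>\<pi>. \<phi> (\<pi> (Suc i)) (X (\<pi> \<circ> Transposition.transpose l (Suc i)) i))
    \<le> perm_avg n \<psi> + (if l \<in> {1..i} then d l else 0)" if l: "l \<in> {1..n}" for l
  proof (cases "l \<in> {1..i}")
    case True
    have "perm_avg n (\<lambda>\<pi>. \<phi> (\<pi> (Suc i)) (X (\<pi> \<circ> Transposition.transpose l (Suc i)) i))
        \<le> perm_avg n (\<lambda>\<pi>. \<psi> \<pi> + d l)"
    proof (rule perm_avg_mono)
      fix \<pi> assume \<pi>: "\<pi> permutes {1..n}"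
      have \<pi>': "(\<pi> \<circ> Transposition.transpose l (Suc i)) permutes {1..n}"
        using True i by (intro permutes_compose[OF permutes_swap_id \<pi>]) auto
      show "\<phi> (\<pi> (Suc i)) (X (\<pi> \<circ> Transposition.transpose l (Suc i)) i) \<le> \<psi> \<pi> + d l"
        using True i \<pi>' \<pi> by (intro swap swapped_iterate_close X_in ballI grad_le) auto
    qed
    then show ?thesis using True by (simp add: perm_avg_simps)
  next
    case False
    \<comment> \<open>Positions beyond \<open>i\<close> have not been used yet, so this exchange
      does not alter the first \<open>i\<close> steps and costs nothing.\<close>
    have "X (\<pi> \<circ> Transposition.transpose l (Suc i)) i = X \<pi> i" for \<pi>
      using False l by (intro sgd_iterate_cong) (auto simp: Transposition.transpose_def)
    then have "perm_avg n (\<lambda>\<pi>. \<phi> (\<pi> (Suc i)) (X (\<pi> \<circ> Transposition.transpose l (Suc i)) i)) \<le> perm_avg n \<psi>"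
      by (auto intro!: perm_avg_mono base)
    then show ?thesis by (simp only: False if_False)
  qed
  have "real n * perm_avg n (\<lambda>\<pi>. (\<Sum>j=1..n. \<phi> j (X \<pi> i)) / real n) =
      perm_avg n (\<lambda>\<pi>. \<Sum>j=1..n. \<phi> j (X \<pi> i))"
    using n by (simp flip: perm_avg_cmult)
  also have "\<dots> = (\<Sum>l=1..n. perm_avg n (\<lambda>\<pi>. \<phi> (\<pi> (Suc i)) (X (\<pi> \<circ> Transposition.transpose l (Suc i)) i)))"
    using perm_avg_mean[of "Suc i" n \<phi> "\<lambda>\<pi>. X \<pi> i"] i by simp
  also have "\<dots> \<le> (\<Sum>l=1..n. perm_avg n \<psi> + (if l \<in> {1..i} then d l else 0))"
    by (rule sum_mono[OF exchange])
  also have "\<dots> = real n * perm_avg n \<psi> + (\<Sum>l=1..n. if l \<in> {1..i} then d l else 0)"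
    by (simp add: sum.distrib)
  also have "(\<Sum>l=1..n. if l \<in> {1..i} then d l else 0) = (\<Sum>l=1..i. d l)"
    using i by (subst sum.inter_restrict[symmetric]) (auto intro!: sum.cong)
  finally show ?thesis using n by (simp add: field_simps)
qed

end

section \<open>Single steps\<close>

lemma norm_diff_scaleR_sq_le:
  fixes a w :: "'a :: real_inner"
  assumes "0 \<le> \<beta>"
  shows "(norm (a - \<beta> *\<^sub>R w))\<^sup>2 \<le> (1 + \<beta>) * (norm a)\<^sup>2 + \<beta> * (1 + \<beta>) * (norm w)\<^sup>2"
proof -
  have "0 \<le> \<beta> * (norm (a + w))\<^sup>2" using assms by simp
  also have "(norm (a + w))\<^sup>2 = (norm a)\<^sup>2 + 2 * (w \<bullet> a) + (norm w)\<^sup>2"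
    by (simp add: power2_norm_eq_inner inner_add_left inner_add_right inner_commute)
  finally show ?thesis unfolding norm_diff_scaleR_sq by (simp add: algebra_simps power2_eq_square)
qed

text \<open>Young's inequality with weight 16, so that little of the contraction is lost when the
  drift \<open>w\<close> is removed from \<open>u\<close>.\<close>

lemma norm_diff_sq_ge:
  fixes u w :: "'a :: real_inner"
  shows "(norm (u - w))\<^sup>2 \<ge> 15 / 16 * (norm u)\<^sup>2 - 15 * (norm w)\<^sup>2"
proof -
  have "0 \<le> (norm (u - 16 *\<^sub>R w))\<^sup>2" by simp
  then have "0 \<le> (norm u)\<^sup>2 - 32 * (w \<bullet> u) + 256 * (norm w)\<^sup>2"
    unfolding norm_diff_scaleR_sq by simp
  moreover have "(norm (u - w))\<^sup>2 = (norm u)\<^sup>2 - 2 * (w \<bullet> u) + (norm w)\<^sup>2"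
    using norm_diff_scaleR_sq[of u 1 w] by simp
  ultimately show ?thesis by linarith
qed

context convex_finite_sum
begin

text \<open>Adding \<open>e *\<^sub>R g p xs\<close> to the drift turns the gradient into the
  difference \<open>\<Delta>\<close>, which cocoercivity controls by \<open>M\<close>. The cross
  term with \<open>w\<close> and the square of the step cost \<open>e * M / 32\<close> each, which
  leaves \<open>31 / 16\<close> of the factor 2.\<close>

lemma drifted_step:
  assumes p: "p \<in> {1..n}" and y: "y \<in> W" and e: "0 \<le> e" "e * L \<le> 1 / 32" and b: "0 \<le> \<beta>"
  shows "(norm ((y - e *\<^sub>R g p y) - xs + ((1 - \<beta>) *\<^sub>R w + e *\<^sub>R g p xs)))\<^sup>2 \<le>
    (1 + \<beta>) * ((norm (y - xs + w))\<^sup>2 - 31 / 16 * e * ((g p y - g p xs) \<bullet> (y - xs)) +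
      32 * e * L * (norm w)\<^sup>2) + \<beta> * (1 + \<beta>) * (norm w)\<^sup>2"
proof -
  define \<Delta> u M where "\<Delta> = g p y - g p xs" and "u = y - xs + w" and "M = \<Delta> \<bullet> (y - xs)"
  have "(y - e *\<^sub>R g p y) - xs + ((1 - \<beta>) *\<^sub>R w + e *\<^sub>R g p xs) = (u - e *\<^sub>R \<Delta>) - \<beta> *\<^sub>R w"
    by (simp add: u_def \<Delta>_def algebra_simps)
  then have 1: "(norm ((y - e *\<^sub>R g p y) - xs + ((1 - \<beta>) *\<^sub>R w + e *\<^sub>R g p xs)))\<^sup>2 \<le>
      (1 + \<beta>) * (norm (u - e *\<^sub>R \<Delta>))\<^sup>2 + \<beta> * (1 + \<beta>) * (norm w)\<^sup>2"
    using norm_diff_scaleR_sq_le[OF b] by metis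
  have coco: "(norm \<Delta>)\<^sup>2 \<le> L * M" using cocoercive[OF p y xs] by (simp add: \<Delta>_def M_def)
  have M: "M \<ge> 0" using order_trans[OF zero_le_power2 coco] L by (simp add: zero_le_mult_iff)
  have "(norm (u - e *\<^sub>R \<Delta>))\<^sup>2 = (norm u)\<^sup>2 - 2 * e * (M + \<Delta> \<bullet> w) + e\<^sup>2 * (norm \<Delta>)\<^sup>2"
    unfolding norm_diff_scaleR_sq by (simp add: u_def M_def inner_add_right)
  \<comment> \<open>Young's inequality, with weight \<open>32 * L\<close> chosen to match the bound
    \<open>1 / 32\<close> on \<open>e * L\<close>.\<close>
  also have "- 2 * (\<Delta> \<bullet> w) \<le> (norm \<Delta>)\<^sup>2 / (32 * L) + 32 * L * (norm w)\<^sup>2"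
  proof -
    have "0 \<le> (norm (\<Delta> - (- (32 * L)) *\<^sub>R w))\<^sup>2" by simp
    then have "0 \<le> ((norm \<Delta>)\<^sup>2 + 64 * L * (\<Delta> \<bullet> w) + (32 * L)\<^sup>2 * (norm w)\<^sup>2) / (32 * L)"
      unfolding norm_diff_scaleR_sq using L by (simp add: inner_commute)
    also have "\<dots> = (norm \<Delta>)\<^sup>2 / (32 * L) + 2 * (\<Delta> \<bullet> w) + 32 * L * (norm w)\<^sup>2"
      using L by (simp add: field_simps power2_eq_square)
    finally show ?thesis by simp
  qed
  then have "e * (- 2 * (\<Delta> \<bullet> w)) \<le> e * ((norm \<Delta>)\<^sup>2 / (32 * L) + 32 * L * (norm w)\<^sup>2)"
    using e by (intro mult_left_mono) auto
  then have "(norm u)\<^sup>2 - 2 * e * (M + \<Delta> \<bullet> w) + e\<^sup>2 * (norm \<Delta>)\<^sup>2 \<le>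
      (norm u)\<^sup>2 - 2 * e * M + e * ((norm \<Delta>)\<^sup>2 / (32 * L)) + 32 * e * L * (norm w)\<^sup>2 + e\<^sup>2 * (norm \<Delta>)\<^sup>2"
    by (simp add: algebra_simps)
  also have "e * ((norm \<Delta>)\<^sup>2 / (32 * L)) \<le> e * (M / 32)"
    using coco L e by (intro mult_left_mono) (auto simp: field_simps)
  also have "e\<^sup>2 * (norm \<Delta>)\<^sup>2 \<le> e * (M / 32)"
  proof -
    have "e\<^sup>2 * (norm \<Delta>)\<^sup>2 \<le> e\<^sup>2 * (L * M)" using coco by (intro mult_left_mono) auto
    also have "\<dots> = e * ((e * L) * M)" by (simp add: power2_eq_square)
    also have "\<dots> \<le> e * ((1 / 32) * M)" using e M by (intro mult_left_mono mult_right_mono) auto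
    finally show ?thesis by simp
  qed
  finally have "(norm (u - e *\<^sub>R \<Delta>))\<^sup>2 \<le> (norm u)\<^sup>2 - 31 / 16 * e * M + 32 * e * L * (norm w)\<^sup>2"
    by (simp add: algebra_simps)
  then have "(1 + \<beta>) * (norm (u - e *\<^sub>R \<Delta>))\<^sup>2 \<le>
      (1 + \<beta>) * ((norm u)\<^sup>2 - 31 / 16 * e * M + 32 * e * L * (norm w)\<^sup>2)"
    using b by (intro mult_left_mono) auto
  then show ?thesis using 1 unfolding u_def M_def \<Delta>_def by linarith
qed

end

context shuffle_epoch
begin

text \<open>Convexity bounds the progress by the sampled function gap. Decoupling replaces it by the
  gap of the average, which is nonnegative. The constant 20 is 16 from the exchange plus 4 from the
  squared gradient step.\<close>

lemma perm_avg_large_step: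
  assumes i: "i < n"
  shows "perm_avg n (\<lambda>\<pi>. (norm (X \<pi> (Suc i) - xs))\<^sup>2) \<le>
    perm_avg n (\<lambda>\<pi>. (norm (X \<pi> i - xs))\<^sup>2) + 20 * (G\<^sup>2 / L\<^sup>2)"
proof -
  define e where "e = \<eta> (Suc i)"
  have e: "0 \<le> e" "e \<le> 2 / L" using step[of "Suc i"] i by (auto simp: e_def)
  define B where "B = perm_avg n (\<lambda>\<pi>. h (\<pi> (Suc i)) (X \<pi> i))"
  define H where "H = (\<Sum>j=1..n. h j xs) / real n"
  have "perm_avg n (\<lambda>\<pi>. (norm (X \<pi> (Suc i) - xs))\<^sup>2) \<le>
    perm_avg n (\<lambda>\<pi>. (norm (X \<pi> i - xs))\<^sup>2 - 2 * e * (h (\<pi> (Suc i)) (X \<pi> i) - h (\<pi> (Suc i)) xs) + e\<^sup>2 * G\<^sup>2)"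
  proof (rule perm_avg_mono)
    fix \<pi> assume \<pi>: "\<pi> permutes {1..n}"
    define y p where "y = X \<pi> i" and "p = \<pi> (Suc i)"
    have p: "p \<in> {1..n}" unfolding p_def using permutes_in_image[OF \<pi>, of "Suc i"] i by auto
    have y: "y \<in> W" unfolding y_def using X_in[OF \<pi>] i by auto
    have "h p y - h p xs \<le> g p y \<bullet> (y - xs)"
      using convex[OF p y xs] by (simp add: inner_diff_right)
    then have "2 * e * (h p y - h p xs) \<le> 2 * e * (g p y \<bullet> (y - xs))"
      using e by (intro mult_left_mono) auto
    moreover have "e\<^sup>2 * (norm (g p y))\<^sup>2 \<le> e\<^sup>2 * G\<^sup>2"
      using grad_le[OF \<pi> _ p, of i] i by (intro mult_left_mono power_mono) (auto simp: y_def)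
    moreover have "X \<pi> (Suc i) - xs = (y - xs) - e *\<^sub>R g p y" by (simp add: y_def p_def e_def)
    ultimately show "(norm (X \<pi> (Suc i) - xs))\<^sup>2 \<le> (norm (X \<pi> i - xs))\<^sup>2 -
        2 * e * (h (\<pi> (Suc i)) (X \<pi> i) - h (\<pi> (Suc i)) xs) + e\<^sup>2 * G\<^sup>2"
      by (simp only: norm_diff_scaleR_sq flip: y_def p_def)
  qed
  also have "\<dots> = perm_avg n (\<lambda>\<pi>. (norm (X \<pi> i - xs))\<^sup>2) - 2 * e * (B - H) + e\<^sup>2 * G\<^sup>2"
    using perm_avg_apply[of "Suc i" n "\<lambda>j. h j xs"] i by (simp add: perm_avg_simps B_def H_def)
  finally have 1: "perm_avg n (\<lambda>\<pi>. (norm (X \<pi> (Suc i) - xs))\<^sup>2) \<le>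
    perm_avg n (\<lambda>\<pi>. (norm (X \<pi> i - xs))\<^sup>2) - 2 * e * (B - H) + e\<^sup>2 * G\<^sup>2" .
  have "H = perm_avg n (\<lambda>\<pi>. H)" by (simp add: perm_avg_const)
  also have "\<dots> \<le> perm_avg n (\<lambda>\<pi>. (\<Sum>j=1..n. h j (X \<pi> i)) / real n)"
  proof (rule perm_avg_mono)
    fix \<pi> assume "\<pi> permutes {1..n}"
    then have "X \<pi> i \<in> W" using X_in i by auto
    moreover have "0 \<le> \<mu> / 2 * (norm (X \<pi> i - xs))\<^sup>2" using mu by simp
    ultimately show "H \<le> (\<Sum>j=1..n. h j (X \<pi> i)) / real n"
      using growth[of "X \<pi> i"] unfolding H_def by linarith
  qed
  also have "\<dots> \<le> B + (\<Sum>l=1..i. G * (2 * \<eta> l * G)) / real n"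
    unfolding B_def
  proof (rule perm_avg_decouple[OF i])
    fix \<pi> y l assume \<pi>: "\<pi> permutes {1..n}" and y: "y \<in> W" "\<forall>j\<in>{1..n}. norm (g j y) \<le> G"
      and d: "norm (y - X \<pi> i) \<le> 2 * \<eta> l * G"
    have p: "\<pi> (Suc i) \<in> {1..n}" using permutes_in_image[OF \<pi>, of "Suc i"] i by auto
    \<comment> \<open>The tangent is taken at the exchanged iterate \<open>y\<close>, where the
      gradient is bounded as well.\<close>
    have "h (\<pi> (Suc i)) y - h (\<pi> (Suc i)) (X \<pi> i) \<le> g (\<pi> (Suc i)) y \<bullet> (y - X \<pi> i)"
      using convex[OF p y(1) X_in[OF \<pi>, of i]] i by (simp add: inner_diff_right)
    also have "\<dots> \<le> norm (g (\<pi> (Suc i)) y) * norm (y - X \<pi> i)" by (rule norm_cauchy_schwarz)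
    also have "\<dots> \<le> G * (2 * \<eta> l * G)" using y p d G_nonneg by (intro mult_mono) auto
    finally show "h (\<pi> (Suc i)) y \<le> h (\<pi> (Suc i)) (X \<pi> i) + G * (2 * \<eta> l * G)" by simp
  qed simp
  also have "(\<Sum>l=1..i. G * (2 * \<eta> l * G)) \<le> (\<Sum>l=1..i. G * (2 * (2 / L) * G))"
    using i G_nonneg step by (intro sum_mono mult_left_mono mult_right_mono) auto
  also have "\<dots> \<le> real n * (4 * G\<^sup>2 / L)"
    using i L G_nonneg by (auto simp: power2_eq_square field_simps intro!: mult_left_mono)
  also have "\<dots> / real n = 4 * G\<^sup>2 / L" using n by simp
  finally have HB: "H \<le> B + 4 * G\<^sup>2 / L" using n by (simp add: divide_right_mono)
  have "2 * e * (H - B) \<le> 2 * e * (4 * G\<^sup>2 / L)" using HB e by (intro mult_left_mono) auto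
  also have "\<dots> \<le> 2 * (2 / L) * (4 * G\<^sup>2 / L)" using e L by (intro mult_right_mono mult_left_mono) auto
  also have "\<dots> = 16 * (G\<^sup>2 / L\<^sup>2)" by (simp add: power2_eq_square)
  finally have 2: "2 * e * (H - B) \<le> 16 * (G\<^sup>2 / L\<^sup>2)" .
  have "e\<^sup>2 * G\<^sup>2 \<le> (2 / L)\<^sup>2 * G\<^sup>2" using e by (intro mult_right_mono power_mono) auto
  then have 3: "e\<^sup>2 * G\<^sup>2 \<le> 4 * (G\<^sup>2 / L\<^sup>2)" by (simp add: power_divide)
  show ?thesis using 1 2 3 unfolding right_diff_distrib by linarith
qed

text \<open>
  The iterate is compared with \<open>xs - w\<close>: the drift \<open>w\<close> accumulates the noise \<open>g j xs\<close>, and this removes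
  the cross term \<open>g (\<pi> i) xs \<bullet> (x - xs)\<close> that would limit the accuracy to that of plain SGD.
\<close>

lemma perm_avg_small_step:
  fixes a b
  defines "w \<equiv> drift (\<lambda>j. g j xs) a b"
  defines "U \<equiv> \<lambda>i. perm_avg n (\<lambda>\<pi>. (norm (X \<pi> i - xs + w \<pi> i))\<^sup>2)"
    and "V \<equiv> \<lambda>i. perm_avg n (\<lambda>\<pi>. (norm (w \<pi> i))\<^sup>2)"
  assumes i: "i < n" and small: "\<eta> (Suc i) * L \<le> 1 / 32"
    and b: "0 \<le> \<beta>" "\<beta> \<le> 3 / 8 * (\<eta> (Suc i) * \<mu>)"
    and ab: "a (Suc i) = 1 - \<beta>" "b (Suc i) = \<eta> (Suc i)"
  shows "U (Suc i) \<le> (1 - 29 / 32 * (\<eta> (Suc i) * \<mu>) + \<beta>) * U i + 96 * (\<eta> (Suc i) * L) * V i +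
    4 * (\<eta> (Suc i) * L) * ((\<Sum>l=1..i. (2 * \<eta> l * G)\<^sup>2) / real n)"
proof -
  define e where "e = \<eta> (Suc i)"
  define D where "D = (\<Sum>l=1..i. (2 * \<eta> l * G)\<^sup>2) / real n"
  define M where "M = perm_avg n (\<lambda>\<pi>. (g (\<pi> (Suc i)) (X \<pi> i) - g (\<pi> (Suc i)) xs) \<bullet> (X \<pi> i - xs))"
  have e: "0 \<le> e" "e * L \<le> 1 / 32" using step[of "Suc i"] i small by (auto simp: e_def)
  have pin: "\<pi> (Suc i) \<in> {1..n}" if "\<pi> permutes {1..n}" for \<pi>
    using permutes_in_image[OF that, of "Suc i"] i by auto
  have U0: "U i \<ge> 0" and V0: "V i \<ge> 0"
    using perm_avg_mono[of n "\<lambda>_. 0"] unfolding U_def V_def by (simp_all add: perm_avg_const)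
  have D0: "D \<ge> 0" by (simp add: D_def sum_nonneg)
  have "U (Suc i) \<le> perm_avg n (\<lambda>\<pi>. (1 + \<beta>) * ((norm (X \<pi> i - xs + w \<pi> i))\<^sup>2 -
      31 / 16 * e * ((g (\<pi> (Suc i)) (X \<pi> i) - g (\<pi> (Suc i)) xs) \<bullet> (X \<pi> i - xs)) +
      32 * e * L * (norm (w \<pi> i))\<^sup>2) + \<beta> * (1 + \<beta>) * (norm (w \<pi> i))\<^sup>2)"
    unfolding U_def
  proof (rule perm_avg_mono)
    fix \<pi> assume \<pi>: "\<pi> permutes {1..n}"
    show "(norm (X \<pi> (Suc i) - xs + w \<pi> (Suc i)))\<^sup>2 \<le> (1 + \<beta>) * ((norm (X \<pi> i - xs + w \<pi> i))\<^sup>2 -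
      31 / 16 * e * ((g (\<pi> (Suc i)) (X \<pi> i) - g (\<pi> (Suc i)) xs) \<bullet> (X \<pi> i - xs)) +
      32 * e * L * (norm (w \<pi> i))\<^sup>2) + \<beta> * (1 + \<beta>) * (norm (w \<pi> i))\<^sup>2"
      using drifted_step[OF pin[OF \<pi>] X_in[OF \<pi>, of i] e b(1), of "w \<pi> i"] i ab
      by (simp add: w_def e_def)
  qed
  also have "\<dots> = (1 + \<beta>) * (U i - 31 / 16 * e * M + 32 * e * L * V i) + \<beta> * (1 + \<beta>) * V i"
    unfolding U_def V_def M_def by (simp only: perm_avg_simps)
  finally have 1: "U (Suc i) \<le> (1 + \<beta>) * (U i - 31 / 16 * e * M + 32 * e * L * V i) + \<beta> * (1 + \<beta>) * V i" .
  have "15 / 16 * U i - 15 * V i = perm_avg n (\<lambda>\<pi>. 15 / 16 * (norm (X \<pi> i - xs + w \<pi> i))\<^sup>2 - 15 * (norm (w \<pi> i))\<^sup>2)"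
    unfolding U_def V_def by (simp only: perm_avg_simps)
  also have "\<dots> \<le> perm_avg n (\<lambda>\<pi>. (norm (X \<pi> i - xs))\<^sup>2)"
    by (rule perm_avg_mono) (metis norm_diff_sq_ge add_diff_cancel_right')
  finally have "\<mu> / 2 * (15 / 16 * U i - 15 * V i) \<le> \<mu> / 2 * perm_avg n (\<lambda>\<pi>. (norm (X \<pi> i - xs))\<^sup>2)"
    using mu by (intro mult_left_mono) auto
  also have "\<dots> = perm_avg n (\<lambda>\<pi>. \<mu> / 2 * (norm (X \<pi> i - xs))\<^sup>2)" by (simp only: perm_avg_simps)
  also have "\<dots> \<le> perm_avg n (\<lambda>\<pi>. (\<Sum>j=1..n. bregman j (X \<pi> i) xs) / real n)"
  proof (rule perm_avg_mono)
    fix \<pi> assume "\<pi> permutes {1..n}"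
    then have "X \<pi> i \<in> W" using X_in i by auto
    note growth[OF this]
    moreover have "(\<Sum>j=1..n. g j xs \<bullet> (X \<pi> i - xs)) = 0"
      using stationary by (simp flip: inner_sum_left)
    ultimately show "\<mu> / 2 * (norm (X \<pi> i - xs))\<^sup>2 \<le> (\<Sum>j=1..n. bregman j (X \<pi> i) xs) / real n"
      by (simp only: sum_subtractf diff_divide_distrib div_0)
  qed
  also have "\<dots> \<le> M + (\<Sum>l=1..i. L * (2 * \<eta> l * G)\<^sup>2) / real n"
    unfolding M_def
  proof (rule perm_avg_decouple[OF i])
    fix \<pi> assume \<pi>: "\<pi> permutes {1..n}"
    define p z where "p = \<pi> (Suc i)" and "z = X \<pi> i"
    have p: "p \<in> {1..n}" and z: "z \<in> W" unfolding p_def z_def using pin[OF \<pi>] X_in[OF \<pi>] i by auto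
    show "bregman p z xs \<le> (g p z - g p xs) \<bullet> (z - xs)"
      using convex[OF p z xs] by (simp add: inner_diff_left inner_diff_right)
    fix y l assume y: "y \<in> W" and d: "norm (y - z) \<le> 2 * \<eta> l * G"
    define \<Delta> where "\<Delta> = g p z - g p xs"
    \<comment> \<open>The unexchanged bound leaves the slack \<open>bregman p xs z\<close>. By
      Young's inequality it absorbs the first order effect of moving from \<open>z\<close> to
      \<open>y\<close>, so the exchange costs only the square of the step size.\<close>
    have "L * (\<Delta> \<bullet> (y - z)) \<le> (norm \<Delta>)\<^sup>2 / 2 + L\<^sup>2 / 2 * (norm (y - z))\<^sup>2"
    proof -
      have "0 \<le> (norm (\<Delta> - L *\<^sub>R (y - z)))\<^sup>2" by simp
      then show ?thesis unfolding norm_diff_scaleR_sq by (simp add: inner_commute)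
    qed
    moreover have "(norm \<Delta>)\<^sup>2 \<le> 2 * L * bregman p xs z"
      using grad_diff_le_bregman[OF p xs z] by (simp add: \<Delta>_def norm_minus_commute)
    ultimately have "L * (\<Delta> \<bullet> (y - z)) \<le> L * (bregman p xs z + L / 2 * (norm (y - z))\<^sup>2)"
      by (simp add: algebra_simps power2_eq_square)
    then have "\<Delta> \<bullet> (y - z) \<le> bregman p xs z + L / 2 * (norm (y - z))\<^sup>2"
      using L by (simp only: mult_le_cancel_left_pos)
    moreover have "bregman p y xs \<le> bregman p z xs + \<Delta> \<bullet> (y - z) + L / 2 * (norm (y - z))\<^sup>2"
      using smooth[OF p z y] by (simp add: \<Delta>_def inner_diff_left inner_diff_right)
    moreover have "bregman p z xs + bregman p xs z = \<Delta> \<bullet> (z - xs)"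
      by (simp add: \<Delta>_def inner_diff_left inner_diff_right)
    moreover have "L * (norm (y - z))\<^sup>2 \<le> L * (2 * \<eta> l * G)\<^sup>2"
      using d L by (intro mult_left_mono power_mono) auto
    ultimately show "bregman p y xs \<le> (g p z - g p xs) \<bullet> (z - xs) + L * (2 * \<eta> l * G)\<^sup>2"
      unfolding \<Delta>_def by linarith
  qed
  also have "\<dots> = M + L * D" by (simp add: D_def sum_distrib_left)
  finally have M: "\<mu> / 2 * (15 / 16 * U i - 15 * V i) - L * D \<le> M" by linarith
  have emu: "e * \<mu> \<le> e * L" using e mu_le_L by (intro mult_left_mono) auto
  have b1: "\<beta> \<le> 1" using b emu e unfolding e_def by linarith
  \<comment> \<open>The contraction factor is
    \<open>31 / 16 * (1 / 2) * (15 / 16) = 465 / 512\<close>, just above the \<open>29 / 32\<close>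
    kept below. The coefficient 47 rounds up \<open>465 / 32 + 32\<close>.\<close>
  have "31 / 16 * e * (\<mu> / 2 * (15 / 16 * U i - 15 * V i) - L * D) \<le> 31 / 16 * e * M"
    using M e by (intro mult_left_mono) auto
  then have "U i - 31 / 16 * e * M + 32 * e * L * V i \<le>
      (U i - 465 / 512 * (e * \<mu>) * U i) + 465 / 32 * ((e * \<mu>) * V i) + 31 / 16 * ((e * L) * D) + 32 * ((e * L) * V i)"
    by (simp add: algebra_simps)
  also have "\<dots> \<le> (1 - 29 / 32 * (e * \<mu>)) * U i + 47 * ((e * L) * V i) + 2 * ((e * L) * D)"
  proof -
    have "(e * \<mu>) * V i \<le> (e * L) * V i" using emu V0 by (rule mult_right_mono)
    moreover have "0 \<le> (e * \<mu>) * U i" "0 \<le> (e * L) * D" "0 \<le> (e * L) * V i"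
      using e mu L U0 V0 D0 by auto
    ultimately show ?thesis by (simp only: left_diff_distrib mult_1_left mult.assoc)
  qed
  finally have "(1 + \<beta>) * (U i - 31 / 16 * e * M + 32 * e * L * V i) \<le>
     (1 + \<beta>) * ((1 - 29 / 32 * (e * \<mu>)) * U i) + (1 + \<beta>) * (47 * ((e * L) * V i)) + (1 + \<beta>) * (2 * ((e * L) * D))"
    using b by (simp only: flip: distrib_left) (intro mult_left_mono, auto)
  also have "(1 + \<beta>) * ((1 - 29 / 32 * (e * \<mu>)) * U i) \<le> (1 - 29 / 32 * (e * \<mu>) + \<beta>) * U i"
  proof -
    have "0 \<le> \<beta> * (29 / 32 * (e * \<mu>))" using b e mu by auto
    then have "(1 + \<beta>) * (1 - 29 / 32 * (e * \<mu>)) \<le> 1 - 29 / 32 * (e * \<mu>) + \<beta>"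
      by (simp add: algebra_simps)
    from mult_right_mono[OF this U0] show ?thesis by (simp only: mult.assoc)
  qed
  also have "(1 + \<beta>) * (47 * ((e * L) * V i)) \<le> 2 * (47 * ((e * L) * V i))"
    using b1 e L V0 by (intro mult_right_mono) auto
  also have "(1 + \<beta>) * (2 * ((e * L) * D)) \<le> 2 * (2 * ((e * L) * D))"
    using b1 e L D0 by (intro mult_right_mono) auto
  finally have 2: "(1 + \<beta>) * (U i - 31 / 16 * e * M + 32 * e * L * V i) \<le>
     (1 - 29 / 32 * (e * \<mu>) + \<beta>) * U i + 94 * (e * L) * V i + 4 * (e * L) * D" by simp
  have "\<beta> * (1 + \<beta>) \<le> \<beta> * 2" using b b1 by (intro mult_left_mono) auto
  also have "\<dots> \<le> 2 * (e * L)" using b emu e L unfolding e_def[symmetric] by linarith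
  finally have 3: "\<beta> * (1 + \<beta>) * V i \<le> 2 * (e * L) * V i" using V0 by (rule mult_right_mono)
  show ?thesis using 1 2 3 unfolding e_def[symmetric] D_def[symmetric]
    by (simp add: algebra_simps)
qed

end

section \<open>Epochs\<close>

lemma linear_recursion_bound:
  fixes u :: "nat \<Rightarrow> real"
  assumes "\<And>i. i < n \<Longrightarrow> u (Suc i) \<le> \<rho> * u i + \<epsilon>" and "0 \<le> \<rho>" "\<rho> \<le> 1" "0 \<le> \<epsilon>" and "i \<le> n"
  shows "u i \<le> \<rho> ^ i * u 0 + real i * \<epsilon>"
  using assms(5)
proof (induction i)
  case (Suc i)
  have "u (Suc i) \<le> \<rho> * (\<rho> ^ i * u 0 + real i * \<epsilon>) + \<epsilon>"
    using assms(1)[of i] mult_left_mono[OF Suc.IH \<open>0 \<le> \<rho>\<close>] Suc.prems by simp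
  moreover have "\<rho> * (real i * \<epsilon>) \<le> 1 * (real i * \<epsilon>)" using assms by (intro mult_right_mono) auto
  ultimately show ?case by (simp add: algebra_simps)
qed simp

text \<open>From \<open>ln (1 + s / T) \<le> s / T\<close>; it turns contraction factors into
  quotients of successive denominators, which telescope.\<close>

lemma contraction_le_powr:
  fixes T s \<alpha> :: real
  assumes "T > 0" "s \<ge> 0" "\<alpha> \<ge> 0"
  shows "exp (- (\<alpha> * s / T)) \<le> (T / (T + s)) powr \<alpha>"
proof -
  have "ln ((T + s) / T) \<le> s / T" using ln_add_one_self_le_self[of "s / T"] assms
    by (simp add: add_divide_distrib)
  moreover have "ln ((T + s) / T) = - ln (T / (T + s))" using assms by (simp add: ln_div)
  ultimately have "\<alpha> * (- (s / T)) \<le> \<alpha> * ln (T / (T + s))" using assms by (intro mult_left_mono) auto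
  then show ?thesis using assms by (simp add: powr_def)
qed

lemma one_minus_le_powr:
  fixes T \<alpha> :: real
  assumes "T > 0" "\<alpha> \<ge> 0"
  shows "1 - \<alpha> / T \<le> (T / (T + 1)) powr \<alpha>"
  using exp_ge_add_one_self[of "- (\<alpha> / T)"] contraction_le_powr[of T 1 \<alpha>] assms by simp

lemma one_minus_power_le_powr:
  fixes T \<alpha> :: real
  assumes "T > 0" "\<alpha> \<ge> 0" "\<alpha> \<le> T"
  shows "(1 - \<alpha> / T) ^ n \<le> (T / (T + real n)) powr \<alpha>"
proof -
  have "(1 - \<alpha> / T) ^ n \<le> exp (- (\<alpha> / T)) ^ n"
    using exp_ge_add_one_self[of "- (\<alpha> / T)"] assms by (intro power_mono) auto
  also have "\<dots> = exp (- (\<alpha> * real n / T))" by (simp add: exp_of_nat_mult[symmetric] mult_ac)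
  also have "\<dots> \<le> (T / (T + real n)) powr \<alpha>" using assms by (intro contraction_le_powr) auto
  finally show ?thesis .
qed

text \<open>The right-hand side is the telescoped value \<open>1 / c - 1 / (c + i)\<close>.\<close>

lemma sum_inverse_squares_shifted_le:
  assumes "(c :: real) > 0"
  shows "(\<Sum>l=1..i. 1 / (c + real l)\<^sup>2) \<le> real i / (c * (c + real i))"
proof (induction i)
  case (Suc i)
  define s where "s = c + real i"
  have s: "s > 0" using assms by (simp add: s_def)
  have eq: "real m / (c * (c + real m)) = 1 / c - 1 / (c + real m)" for m
    using assms by (simp add: field_simps)
  have "1 / (s + 1)\<^sup>2 \<le> 1 / (s * (s + 1))"
    using s by (intro divide_left_mono) (auto simp: power2_eq_square)
  also have "\<dots> = 1 / s - 1 / (s + 1)" using s by (simp add: field_simps)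
  finally have "1 / (s + 1)\<^sup>2 \<le> 1 / s - 1 / (s + 1)" .
  moreover have cs: "c + real (Suc i) = s + 1" by (simp add: s_def)
  have "(\<Sum>l=1..Suc i. 1 / (c + real l)\<^sup>2) = (\<Sum>l=1..i. 1 / (c + real l)\<^sup>2) + 1 / (s + 1)\<^sup>2"
    unfolding cs[symmetric] by simp
  moreover have "(\<Sum>l=1..i. 1 / (c + real l)\<^sup>2) \<le> 1 / c - 1 / s"
    using Suc unfolding eq by (simp add: s_def)
  moreover have "real (Suc i) / (c * (c + real (Suc i))) = 1 / c - 1 / (s + 1)"
    using eq[of "Suc i"] unfolding cs .
  ultimately show ?case by linarith
qed simp

text \<open>Invariance of \<open>A / T\<close> for the second moment of the damped drift: damping
  \<open>3 / 2 / T\<close> exceeds the decay of \<open>A / T\<close> by the amount needed for the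
  new noise.\<close>

lemma damped_recursion:
  fixes T A :: real
  assumes "T > 1" "A \<ge> 0"
  shows "(1 - 3 / 2 / T) * (A / (T - 1)) + A / 2 / T\<^sup>2 \<le> A / T"
proof -
  have "A / T - (1 - 3 / 2 / T) * (A / (T - 1)) = A / 2 / (T * (T - 1))"
    using assms by (simp add: field_simps)
  moreover have "A / 2 / T\<^sup>2 \<le> A / 2 / (T * (T - 1))"
    using assms by (intro divide_left_mono) (auto simp: power2_eq_square)
  ultimately show ?thesis by simp
qed

text \<open>Of the contraction, \<open>2 / T\<close> suffices for the \<open>B\<close> term: one
  part lowers \<open>B / (T - 1)\<close> to \<open>B / T\<close>, the other pays for
  \<open>E\<close>. The \<open>P\<close> term uses the full \<alpha>.\<close>

lemma first_epoch_recursion: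
  fixes T \<alpha> B P E :: real
  assumes "T > 1" "\<alpha> \<ge> 2" "\<alpha> \<le> T" "E \<le> B" "0 \<le> B" "0 \<le> P"
  shows "(1 - \<alpha> / T) * (B / (T - 1) + P / T powr \<alpha>) + E / T\<^sup>2 \<le> B / T + P / (T + 1) powr \<alpha>"
proof -
  have "(1 - \<alpha> / T) * (B / (T - 1)) \<le> (1 - 2 / T) * (B / (T - 1))"
    using assms by (intro mult_right_mono) (auto simp: divide_right_mono)
  also have "\<dots> = B / T - B / (T * (T - 1))" using assms by (simp add: field_simps)
  also have "\<dots> \<le> B / T - E / T\<^sup>2"
  proof -
    have "E / T\<^sup>2 \<le> B / T\<^sup>2" using assms by (intro divide_right_mono) auto
    also have "\<dots> \<le> B / (T * (T - 1))"
      using assms by (intro divide_left_mono) (auto simp: power2_eq_square)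
    finally show ?thesis by simp
  qed
  finally have 1: "(1 - \<alpha> / T) * (B / (T - 1)) \<le> B / T - E / T\<^sup>2" .
  have "(1 - \<alpha> / T) * (P / T powr \<alpha>) \<le> (T / (T + 1)) powr \<alpha> * (P / T powr \<alpha>)"
    using assms by (intro mult_right_mono one_minus_le_powr) auto
  also have "\<dots> = P / (T + 1) powr \<alpha>" using assms by (simp add: powr_divide)
  finally show ?thesis using 1 by (simp add: distrib_left)
qed

section \<open>The squared distance over one epoch\<close>

lemma drift_undamped: "drift v (\<lambda>_. 1) (\<lambda>_. e) \<pi> i = e *\<^sub>R (\<Sum>l=1..i. v (\<pi> l))"
  by (induction i) (simp_all add: scaleR_add_right)

context shuffle_epoch
begin

lemma perm_avg_large_steps:
  "i \<le> n \<Longrightarrow> perm_avg n (\<lambda>\<pi>. (norm (X \<pi> i - xs))\<^sup>2) \<le> (norm (x - xs))\<^sup>2 + real i * (20 * (G\<^sup>2 / L\<^sup>2))"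
proof (induction i)
  case (Suc i)
  then show ?case using perm_avg_large_step[of i] by (simp only: of_nat_Suc distrib_right) linarith
qed (simp add: perm_avg_const)

text \<open>With \<beta> = 0 the drift is \<open>e\<close> times a partial sum of the noise, so it
  vanishes at both ends of the epoch and \<open>U\<close> equals the mean squared distance there. In
  between, negative correlation gives second moment at most
  \<open>i * e\<^sup>2 * s\<close>.\<close>

lemma perm_avg_constant_step_epoch:
  assumes const: "\<And>i. i \<in> {1..n} \<Longrightarrow> \<eta> i = e" and small: "e * L \<le> 1 / 32"
    and s: "(\<Sum>j=1..n. (norm (g j xs))\<^sup>2) / real n \<le> s"
  shows "perm_avg n (\<lambda>\<pi>. (norm (X \<pi> n - xs))\<^sup>2) \<le> (1 - 29 / 32 * (e * \<mu>)) ^ n * (norm (x - xs))\<^sup>2 +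
    real n * (96 * (e * L) * (real n * (e\<^sup>2 * s)) + 16 * (e * L) * (e * G)\<^sup>2)"
proof -
  define w where "w = drift (\<lambda>j. g j xs) (\<lambda>_. 1) (\<lambda>_. e)"
  define U where "U i = perm_avg n (\<lambda>\<pi>. (norm (X \<pi> i - xs + w \<pi> i))\<^sup>2)" for i
  define V where "V i = perm_avg n (\<lambda>\<pi>. (norm (w \<pi> i))\<^sup>2)" for i
  have e: "e \<ge> 0" using step[of n] const[of n] n by auto
  have s0: "s \<ge> 0" using s by (rule order_trans[rotated]) (simp add: sum_nonneg)
  have U0: "U i \<ge> 0" for i
    using perm_avg_mono[of n "\<lambda>_. 0"] unfolding U_def by (simp add: perm_avg_const)
  have V: "V i \<le> real i * (e\<^sup>2 * s)" if "i \<le> n" for i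
    using that
  proof (induction i)
    case (Suc i)
    have "V (Suc i) \<le> V i + e\<^sup>2 * ((\<Sum>j=1..n. (norm (g j xs))\<^sup>2) / real n)"
      using perm_avg_norm_drift_Suc_le[OF stationary, of "\<lambda>_. 1" "\<lambda>_. e" i] e Suc.prems
      by (simp add: V_def w_def)
    also have "\<dots> \<le> real i * (e\<^sup>2 * s) + e\<^sup>2 * s"
      using Suc s by (intro add_mono mult_left_mono) auto
    finally show ?case by (simp add: algebra_simps)
  qed (simp add: V_def w_def perm_avg_const)
  have "U (Suc i) \<le> (1 - 29 / 32 * (e * \<mu>)) * U i +
      (96 * (e * L) * (real n * (e\<^sup>2 * s)) + 16 * (e * L) * (e * G)\<^sup>2)" if i: "i < n" for i
  proof -
    have \<eta>: "\<eta> (Suc i) = e" using const i by auto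
    have "U (Suc i) \<le> (1 - 29 / 32 * (e * \<mu>)) * U i + 96 * (e * L) * V i +
        4 * (e * L) * ((\<Sum>l=1..i. (2 * \<eta> l * G)\<^sup>2) / real n)"
      using perm_avg_small_step[OF i, of 0 "\<lambda>_. 1" "\<lambda>_. e"] small e mu
      unfolding U_def V_def w_def \<eta> by simp
    also have "V i \<le> real n * (e\<^sup>2 * s)"
      using V[of i] i s0 by (meson less_imp_le mult_right_mono of_nat_le_iff order_trans zero_le_power2 mult_nonneg_nonneg)
    also have "(\<Sum>l=1..i. (2 * \<eta> l * G)\<^sup>2) / real n \<le> 4 * (e * G)\<^sup>2"
    proof -
      have "(\<Sum>l=1..i. (2 * \<eta> l * G)\<^sup>2) = (\<Sum>l=1..i. 4 * (e * G)\<^sup>2)"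
        using i const by (intro sum.cong) (auto simp: power_mult_distrib)
      also have "\<dots> = real i * (4 * (e * G)\<^sup>2)" by simp
      also have "\<dots> \<le> real n * (4 * (e * G)\<^sup>2)" using i by (intro mult_right_mono) auto
      finally show ?thesis using n by (simp add: field_simps)
    qed
    finally show ?thesis using e L by (simp add: mult_left_mono)
  qed
  moreover have "e * \<mu> \<le> e * L" using e mu_le_L by (intro mult_left_mono) auto
  ultimately have "U n \<le> (1 - 29 / 32 * (e * \<mu>)) ^ n * U 0 +
      real n * (96 * (e * L) * (real n * (e\<^sup>2 * s)) + 16 * (e * L) * (e * G)\<^sup>2)"
    using e mu L s0 small by (intro linear_recursion_bound[where n = n]) auto
  moreover have "w \<pi> n = 0" if \<pi>: "\<pi> permutes {1..n}" for \<pi>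
    using sum.permute[OF \<pi>, of "\<lambda>j. g j xs"] stationary
    by (simp add: w_def drift_undamped comp_def)
  then have "U n = perm_avg n (\<lambda>\<pi>. (norm (X \<pi> n - xs))\<^sup>2)"
    unfolding U_def by (intro perm_avg_cong) simp
  moreover have "U 0 = (norm (x - xs))\<^sup>2" by (simp add: U_def w_def perm_avg_const)
  ultimately show ?thesis by simp
qed

text \<open>Induction on the invariant \<open>B / T i + P / (T i + 1) powr \<alpha>\<close> for
  \<open>U\<close>: while \<open>T i < 64 * k0\<close> only the bounded growth of the distance is
  used, afterwards the contraction with drift. At the end the drift is removed at the cost of a
  factor 2.\<close>

lemma perm_avg_first_epoch:
  fixes \<alpha> \<kappa> k0 Q R :: real
  assumes \<alpha>: "\<alpha> > 2" and \<kappa>: "\<kappa> = L / \<mu>" and k0: "k0 = \<alpha> * \<kappa>" and Q: "Q = G\<^sup>2 / L\<^sup>2"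
    and \<eta>: "\<And>i. i \<in> {1..n} \<Longrightarrow> \<eta> i = (2 * \<alpha> / \<mu>) / (k0 + real i)"
    and s: "(\<Sum>j=1..n. (norm (g j xs))\<^sup>2) / real n \<le> 4 * \<kappa> * G\<^sup>2"
    and end_large: "64 * k0 \<le> k0 + real n"
  shows "perm_avg n (\<lambda>\<pi>. (norm (X \<pi> n - xs))\<^sup>2) \<le> 163904 * (\<alpha> ^ 3 * \<kappa> ^ 4 * Q) / (k0 + real n) +
    2 * ((norm (x - xs))\<^sup>2 * (65 * k0) powr \<alpha>) / (k0 + real n + 1) powr \<alpha>"
proof -
  have \<kappa>1: "\<kappa> \<ge> 1" using mu mu_le_L by (simp add: \<kappa>)
  have \<alpha>k0: "\<alpha> \<le> k0" using mult_left_mono[OF \<kappa>1, of \<alpha>] \<alpha> by (simp add: k0)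
  then have k02: "k0 > 2" using \<alpha> by simp
  have Q0: "Q \<ge> 0" by (simp add: Q)
  define T where "T i = k0 + real i" for i
  have T: "T i \<ge> k0" for i by (simp add: T_def)
  have TS: "T (Suc i) = T i + 1" for i by (simp add: T_def)
  have \<eta>T: "\<eta> i * L = 2 * k0 / T i" "\<eta> i * \<mu> = 2 * \<alpha> / T i" if "i \<in> {1..n}" for i
    using mu by (auto simp: \<eta>[OF that] T_def k0 \<kappa>)
  \<comment> \<open>\<open>A\<close> is twice the noise injected per step, scaled by the squared
    denominator, as \<open>damped_recursion\<close> requires. In \<open>B\<close>, 81920 is
    \<open>64 * 20 * 64\<close>, from the growth \<open>20 * Q\<close> per step while
    \<open>T i \<le> 64 * k0\<close>; then also \<open>T i + 1 \<le> 65 * k0\<close>, which explains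
    \<open>P\<close>.\<close>
  define A where "A = 32 * (\<alpha>\<^sup>2 * \<kappa> ^ 3 * Q)"
  define B where "B = 81920 * (\<alpha> ^ 3 * \<kappa> ^ 4 * Q)"
  define P where "P = (norm (x - xs))\<^sup>2 * (65 * k0) powr \<alpha>"
  have A0: "A \<ge> 0" and B0: "B \<ge> 0" and P0: "P \<ge> 0"
    using \<alpha> \<kappa>1 Q0 by (auto simp: A_def B_def P_def)
  \<comment> \<open>The drift starts only once the steps are small, and it is damped: with decreasing steps its undamped
    version would not return to 0 at the end of the epoch but stay at the size of the first steps.\<close>
  define a where "a i = (if T i < 64 * k0 then 0 else 1 - 3 / 2 / T i)" for i
  define b where "b i = (if T i < 64 * k0 then 0 else (2 * \<alpha> / \<mu>) / T i)" for i
  have a0: "a i \<ge> 0" and a1: "a i \<le> 1" for i using k02 T[of i] by (auto simp: a_def field_simps)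
  have b0: "b i \<ge> 0" for i using \<alpha> mu k02 T[of i] by (auto simp: b_def)
  define w where "w = drift (\<lambda>j. g j xs) a b"
  define U where "U i = perm_avg n (\<lambda>\<pi>. (norm (X \<pi> i - xs + w \<pi> i))\<^sup>2)" for i
  define V where "V i = perm_avg n (\<lambda>\<pi>. (norm (w \<pi> i))\<^sup>2)" for i
  have U0: "U i \<ge> 0" and V0: "V i \<ge> 0" for i
    using perm_avg_mono[of n "\<lambda>_. 0"] unfolding U_def V_def by (simp_all add: perm_avg_const)
  have w0: "w \<pi> i = 0" if "T i < 64 * k0" for \<pi> i
    using that by (cases i) (auto simp: w_def a_def b_def)
  have V: "V i \<le> A / T i" if "i \<le> n" for i
    using that
  proof (induction i)
    case 0
    show ?case using A0 T[of 0] k02 by (simp add: V_def w_def perm_avg_const)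
  next
    case (Suc i)
    define t where "t = T (Suc i)"
    have t: "t > 1" using T[of "Suc i"] k02 by (simp add: t_def)
    show ?case
    proof (cases "t < 64 * k0")
      case True
      then show ?thesis using A0 t by (simp add: V_def w0 t_def perm_avg_const)
    next
      case False
      have "V (Suc i) \<le> (a (Suc i))\<^sup>2 * V i + (b (Suc i))\<^sup>2 * ((\<Sum>j=1..n. (norm (g j xs))\<^sup>2) / real n)"
        using perm_avg_norm_drift_Suc_le[OF stationary a0 b0, where i = i] Suc.prems by (simp add: V_def w_def)
      also have "(a (Suc i))\<^sup>2 * V i \<le> a (Suc i) * (A / T i)"
        using a0 a1 Suc V0 by (intro mult_mono) (auto simp: power2_eq_square mult_left_le)
      also have "(b (Suc i))\<^sup>2 * ((\<Sum>j=1..n. (norm (g j xs))\<^sup>2) / real n) \<le> (b (Suc i))\<^sup>2 * (4 * \<kappa> * G\<^sup>2)"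
        using s by (intro mult_left_mono) auto
      also have "(b (Suc i))\<^sup>2 * (4 * \<kappa> * G\<^sup>2) = A / 2 / t\<^sup>2"
        using False L mu by (simp add: b_def A_def t_def Q \<kappa> power_divide power_mult_distrib)
          (simp add: field_simps power2_eq_square power3_eq_cube)
      also have "a (Suc i) * (A / T i) = (1 - 3 / 2 / t) * (A / (t - 1))"
        using False by (simp add: a_def t_def TS)
      also have "(1 - 3 / 2 / t) * (A / (t - 1)) + A / 2 / t\<^sup>2 \<le> A / t"
        using t A0 by (rule damped_recursion)
      finally show ?thesis by (simp add: t_def)
    qed
  qed
  have D: "(\<Sum>l=1..i. (2 * \<eta> l * G)\<^sup>2) / real n \<le> 16 * (\<alpha>\<^sup>2 * \<kappa>\<^sup>2 * Q) / T i" if "i \<le> n" for i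
  proof -
    have "(\<Sum>l=1..i. (2 * \<eta> l * G)\<^sup>2) = (\<Sum>l=1..i. 16 * (\<alpha>\<^sup>2 * \<kappa>\<^sup>2 * Q) * (1 / (k0 + real l)\<^sup>2))"
      using that L mu by (intro sum.cong)
        (auto simp: \<eta> \<kappa> Q power_divide power_mult_distrib)
    also have "\<dots> = 16 * (\<alpha>\<^sup>2 * \<kappa>\<^sup>2 * Q) * (\<Sum>l=1..i. 1 / (k0 + real l)\<^sup>2)"
      by (simp only: sum_distrib_left)
    also have "\<dots> \<le> 16 * (\<alpha>\<^sup>2 * \<kappa>\<^sup>2 * Q) * (real i / (k0 * T i))"
      unfolding T_def using k02 Q0 by (intro mult_left_mono sum_inverse_squares_shifted_le) auto
    also have "\<dots> \<le> 16 * (\<alpha>\<^sup>2 * \<kappa>\<^sup>2 * Q) * (real n / T i)"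
      using mult_mono[of "real i" "real n" 1 k0] that k02 T[of i] Q0
      by (intro mult_left_mono) (simp_all add: divide_simps)
    finally show ?thesis using n by (simp add: divide_le_eq)
  qed
  have large: "U i \<le> B / T i + P / (T i + 1) powr \<alpha>" if i: "i \<le> n" and Ti: "T i < 64 * k0 \<or> i = 0" for i
  proof -
    have Ti': "T i \<le> 64 * k0" using Ti k02 by (auto simp: T_def)
    have "w \<pi> i = 0" for \<pi> using Ti w0 by (auto simp: w_def)
    then have "U i \<le> (norm (x - xs))\<^sup>2 + real i * (20 * Q)"
      using perm_avg_large_steps[OF i] by (simp add: U_def Q)
    moreover have "(norm (x - xs))\<^sup>2 \<le> P / (T i + 1) powr \<alpha>"
    proof -
      have "(T i + 1) powr \<alpha> \<le> (65 * k0) powr \<alpha>"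
        using Ti' T[of i] k02 \<alpha> by (intro powr_mono2) auto
      then show ?thesis using T[of i] k02
        by (simp add: P_def le_divide_eq mult_left_mono powr_gt_zero)
    qed
    moreover have "real i * (20 * Q) \<le> B / T i"
    proof -
      have "real i * (20 * Q) * T i \<le> (64 * k0) * (20 * Q) * (64 * k0)"
        using Ti' T[of i] k02 Q0 by (intro mult_mono) (auto simp: T_def)
      also have "\<dots> = 81920 * (\<alpha>\<^sup>2 * \<kappa>\<^sup>2 * Q)" by (simp add: k0 power2_eq_square)
      also have "\<dots> \<le> B" unfolding B_def
        using \<alpha> \<kappa>1 Q0 by (intro mult_left_mono mult_right_mono mult_mono power_increasing) auto
      finally show ?thesis using T[of i] k02 by (simp add: le_divide_eq)
    qed
    ultimately show ?thesis by simp
  qed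
  have "U i \<le> B / T i + P / (T i + 1) powr \<alpha>" if "i \<le> n" for i
    using that
  proof (induction i)
    case 0
    show ?case by (rule large) auto
  next
    case (Suc i)
    define t where "t = T (Suc i)"
    show ?case
    proof (cases "t < 64 * k0")
      case True
      then show ?thesis using Suc.prems by (intro large) (auto simp: t_def)
    next
      case False
      have t: "t \<ge> 64 * k0" "t > 2" "T i = t - 1" using False k02 by (auto simp: t_def TS)
      have i: "i < n" using Suc.prems by simp
      have \<eta>i: "\<eta> (Suc i) * L = 2 * k0 / t" "\<eta> (Suc i) * \<mu> = 2 * \<alpha> / t"
        using \<eta>T[of "Suc i"] i by (auto simp: t_def)
      \<comment> \<open>The bounds for \<open>V i\<close> and the exchange error have denominator
        \<open>t - 1\<close>; this factor 2 replaces it by \<open>t\<close>.\<close>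
      have E: "1 / (t - 1) \<le> 2 / t" using t by (simp add: field_simps)
      have "U (Suc i) \<le> (1 - 29 / 32 * (\<eta> (Suc i) * \<mu>) + 3 / 2 / t) * U i + 96 * (\<eta> (Suc i) * L) * V i +
          4 * (\<eta> (Suc i) * L) * ((\<Sum>l=1..i. (2 * \<eta> l * G)\<^sup>2) / real n)"
        unfolding U_def V_def w_def
      proof (rule perm_avg_small_step[OF i])
        show "\<eta> (Suc i) * L \<le> 1 / 32" unfolding \<eta>i using t by (simp add: field_simps)
        show "3 / 2 / t \<le> 3 / 8 * (\<eta> (Suc i) * \<mu>)" unfolding \<eta>i using t \<alpha> by (simp add: field_simps)
        show "a (Suc i) = 1 - 3 / 2 / t" using False by (simp add: a_def t_def)
        show "b (Suc i) = \<eta> (Suc i)" using False i by (simp add: b_def t_def \<eta> T_def)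
      qed (use t in simp)
      \<comment> \<open>The net rate \<open>29 / 16 * \<alpha> - 3 / 2\<close> is at least \<alpha>,
        because \<open>13 / 16 * \<alpha>\<close> exceeds \<open>3 / 2\<close>.\<close>
      also have "(1 - 29 / 32 * (\<eta> (Suc i) * \<mu>) + 3 / 2 / t) * U i \<le> (1 - \<alpha> / t) * U i"
        using t \<alpha> U0 unfolding \<eta>i by (intro mult_right_mono) (auto simp: field_simps)
      also have "(1 - \<alpha> / t) * U i \<le> (1 - \<alpha> / t) * (B / (t - 1) + P / t powr \<alpha>)"
        using Suc i t \<alpha>k0 k02 by (intro mult_left_mono) auto
      also have "96 * (\<eta> (Suc i) * L) * V i \<le> 12288 * (\<alpha> ^ 3 * \<kappa> ^ 4 * Q) / t\<^sup>2"
      proof -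
        have "V i \<le> A * (1 / (t - 1))" using V[of i] i t by simp
        also have "\<dots> \<le> A * (2 / t)" using E A0 by (intro mult_left_mono) auto
        finally have "96 * (\<eta> (Suc i) * L) * V i \<le> 96 * (2 * k0 / t) * (A * (2 / t))"
          unfolding \<eta>i using t k02 by (intro mult_left_mono) auto
        also have "\<dots> = 12288 * (\<alpha> ^ 3 * \<kappa> ^ 4 * Q) / t\<^sup>2"
          by (simp add: A_def k0 power2_eq_square power3_eq_cube power4_eq_xxxx)
        finally show ?thesis .
      qed
      also have "4 * (\<eta> (Suc i) * L) * ((\<Sum>l=1..i. (2 * \<eta> l * G)\<^sup>2) / real n) \<le>
          256 * (\<alpha> ^ 3 * \<kappa> ^ 4 * Q) / t\<^sup>2"
      proof -
        have "(\<Sum>l=1..i. (2 * \<eta> l * G)\<^sup>2) / real n \<le> 16 * (\<alpha>\<^sup>2 * \<kappa>\<^sup>2 * Q) * (1 / (t - 1))"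
          using D[of i] i t by simp
        also have "\<dots> \<le> 16 * (\<alpha>\<^sup>2 * \<kappa>\<^sup>2 * Q) * (2 / t)" using E Q0 by (intro mult_left_mono) auto
        also have "\<dots> \<le> 16 * (\<alpha>\<^sup>2 * \<kappa> ^ 3 * Q) * (2 / t)"
          using t Q0 \<kappa>1 by (intro mult_right_mono mult_left_mono power_increasing) auto
        finally have "4 * (\<eta> (Suc i) * L) * ((\<Sum>l=1..i. (2 * \<eta> l * G)\<^sup>2) / real n) \<le>
            4 * (2 * k0 / t) * (16 * (\<alpha>\<^sup>2 * \<kappa> ^ 3 * Q) * (2 / t))"
          unfolding \<eta>i using t k02 by (intro mult_left_mono) auto
        also have "\<dots> = 256 * (\<alpha> ^ 3 * \<kappa> ^ 4 * Q) / t\<^sup>2"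
          by (simp add: k0 power2_eq_square power3_eq_cube power4_eq_xxxx)
        finally show ?thesis .
      qed
      finally have "U (Suc i) \<le> (1 - \<alpha> / t) * (B / (t - 1) + P / t powr \<alpha>) +
          12288 * (\<alpha> ^ 3 * \<kappa> ^ 4 * Q) / t\<^sup>2 + 256 * (\<alpha> ^ 3 * \<kappa> ^ 4 * Q) / t\<^sup>2" by simp
      moreover have "12288 * Z / t\<^sup>2 + 256 * Z / t\<^sup>2 = 12544 * Z / t\<^sup>2" for Z
        by (simp flip: add_divide_distrib)
      ultimately have "U (Suc i) \<le> (1 - \<alpha> / t) * (B / (t - 1) + P / t powr \<alpha>) +
          12544 * (\<alpha> ^ 3 * \<kappa> ^ 4 * Q) / t\<^sup>2" by (metis add.assoc)
      also have "\<dots> \<le> B / t + P / (t + 1) powr \<alpha>"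
        using t \<alpha> \<alpha>k0 k02 B0 P0 Q0 \<kappa>1 by (intro first_epoch_recursion) (auto simp: B_def)
      finally show ?thesis by (simp add: t_def)
    qed
  qed
  from this[of n] have Un: "U n \<le> B / T n + P / (T n + 1) powr \<alpha>" by simp
  have "perm_avg n (\<lambda>\<pi>. (norm (X \<pi> n - xs))\<^sup>2) \<le>
      perm_avg n (\<lambda>\<pi>. 2 * (norm (X \<pi> n - xs + w \<pi> n))\<^sup>2 + 2 * (norm (w \<pi> n))\<^sup>2)"
  proof (rule perm_avg_mono)
    fix \<pi>
    show "(norm (X \<pi> n - xs))\<^sup>2 \<le> 2 * (norm (X \<pi> n - xs + w \<pi> n))\<^sup>2 + 2 * (norm (w \<pi> n))\<^sup>2"
      using norm_diff_scaleR_sq_le[of 1 "X \<pi> n - xs + w \<pi> n" "w \<pi> n"] by simp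
  qed
  also have "\<dots> = 2 * U n + 2 * V n" by (simp only: perm_avg_simps U_def V_def)
  also have "\<dots> \<le> 2 * (B / T n + P / (T n + 1) powr \<alpha>) + 2 * (A / T n)" using Un V[of n] by simp
  also have "\<dots> = (2 * B + 2 * A) / T n + 2 * P / (T n + 1) powr \<alpha>" by (simp add: add_divide_distrib)
  also have "\<dots> \<le> 163904 * (\<alpha> ^ 3 * \<kappa> ^ 4 * Q) / T n + 2 * P / (T n + 1) powr \<alpha>"
  proof -
    have "\<alpha>\<^sup>2 * \<kappa> ^ 3 * Q \<le> \<alpha> ^ 3 * \<kappa> ^ 4 * Q"
      using \<alpha> \<kappa>1 Q0 by (intro mult_right_mono mult_mono power_increasing) auto
    then have "2 * B + 2 * A \<le> 163904 * (\<alpha> ^ 3 * \<kappa> ^ 4 * Q)" unfolding A_def B_def by linarith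
    then show ?thesis using T[of n] k02 by (simp add: divide_right_mono)
  qed
  finally show ?thesis by (simp add: T_def P_def)
qed

end

text \<open>With \<open>q = T / (T + n)\<close> the epoch contracts by at most
  \<open>q powr (3 / 2 * \<alpha>)\<close>, hence by \<open>q ^ 3\<close>, whereas keeping the
  \<open>B\<close> term needs only \<open>q\<^sup>2\<close>. The surplus is
  \<open>q ^ 3 * n / T\<close>, and \<open>q \<ge> 2 / 3\<close> gives
  \<open>q ^ 3 \<ge> 1 / 4\<close>, enough to pay for \<open>E\<close>.\<close>

lemma late_epoch_recursion:
  fixes T \<alpha> B P E :: real and n :: nat
  assumes n: "n \<ge> 1" and T: "2 * real n \<le> T" "3 / 2 * \<alpha> \<le> T" and \<alpha>: "\<alpha> \<ge> 2" and E: "4 * E \<le> B"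
    and B: "0 \<le> B" and P: "0 \<le> P" and \<rho>: "0 \<le> \<rho>" "\<rho> \<le> 1 - 3 / 2 * \<alpha> / T"
  shows "\<rho> ^ n * (B * n / T\<^sup>2 + P / T powr \<alpha>) + E * (real n)\<^sup>2 / T ^ 3 \<le>
    B * n / (T + n)\<^sup>2 + P / (T + n) powr \<alpha>"
proof -
  define q where "q = T / (T + n)"
  have T0: "T > 0" using T n by linarith
  have q: "0 < q" "q \<le> 1" "2 / 3 \<le> q" using T T0 by (auto simp: q_def field_simps)
  have "\<rho> ^ n \<le> (1 - (3 / 2 * \<alpha>) / T) ^ n" using \<rho> by (intro power_mono) auto
  also have "\<dots> \<le> q powr (3 / 2 * \<alpha>)" unfolding q_def using T T0 \<alpha> by (intro one_minus_power_le_powr) auto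
  finally have rq: "\<rho> ^ n \<le> q powr (3 / 2 * \<alpha>)" .
  also have "\<dots> \<le> q powr \<alpha>" using q \<alpha> by (intro powr_mono') auto
  finally have "\<rho> ^ n * (P / T powr \<alpha>) \<le> q powr \<alpha> * (P / T powr \<alpha>)" using P by (intro mult_right_mono) auto
  also have "\<dots> = P / (T + n) powr \<alpha>" using T0 by (simp add: q_def powr_divide)
  finally have 1: "\<rho> ^ n * (P / T powr \<alpha>) \<le> P / (T + n) powr \<alpha>" .
  have "q powr (3 / 2 * \<alpha>) \<le> q powr 3" using q \<alpha> by (intro powr_mono') auto
  also have "\<dots> = q ^ 3" using q by simp
  finally have "\<rho> ^ n * (B * n / T\<^sup>2) \<le> q ^ 3 * (B * n / T\<^sup>2)"
    using rq B by (intro mult_right_mono) auto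
  also have "\<dots> = q\<^sup>2 * (B * n / T\<^sup>2) - (q ^ 3 * B) * (real n)\<^sup>2 / T ^ 3"
  proof -
    have "q * n / T = n / (T + n)" using T0 by (simp add: q_def)
    moreover have "1 - n / (T + n) = q" using T0 by (simp add: q_def diff_divide_eq_iff)
    ultimately have "q = 1 - q * n / T" by simp
    from arg_cong[OF this, of "\<lambda>z. q\<^sup>2 * z"] have "q ^ 3 = q\<^sup>2 - q ^ 3 * n / T"
      by (simp add: right_diff_distrib power2_eq_square power3_eq_cube)
    from arg_cong[OF this, of "\<lambda>z. z * (B * n / T\<^sup>2)"]
    have "q ^ 3 * (B * n / T\<^sup>2) = q\<^sup>2 * (B * n / T\<^sup>2) - q ^ 3 * n / T * (B * n / T\<^sup>2)"
      by (simp only: left_diff_distrib)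
    moreover have "q ^ 3 * n / T * (B * n / T\<^sup>2) = (q ^ 3 * B) * (real n)\<^sup>2 / T ^ 3"
      by (simp add: power2_eq_square power3_eq_cube mult_ac)
    ultimately show ?thesis by (simp only:)
  qed
  also have "\<dots> \<le> q\<^sup>2 * (B * n / T\<^sup>2) - E * (real n)\<^sup>2 / T ^ 3"
  proof -
    have "(2 / 3) ^ 3 \<le> q ^ 3" using q by (intro power_mono) auto
    then have "1 / 4 \<le> q ^ 3" by (simp add: power3_eq_cube)
    then have "1 / 4 * B \<le> q ^ 3 * B" using B by (rule mult_right_mono)
    then have "E \<le> q ^ 3 * B" using E by simp
    then show ?thesis using T0 by (simp add: divide_right_mono mult_right_mono)
  qed
  also have "q\<^sup>2 * (B * n / T\<^sup>2) = B * n / (T + n)\<^sup>2" using T0 by (simp add: q_def power_divide)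
  finally show ?thesis using 1 by (simp add: distrib_left)
qed

text \<open>Since \<open>xs\<close> may lie outside the region of bounded gradients, they are
  transported from \<open>y\<close>. The Bregman divergences average to the function gap by
  stationarity, and strong convexity bounds this gap by
  \<open>G\<^sup>2 / (2 * \<mu>)\<close>.\<close>

lemma (in convex_finite_sum) gradient_variance_le:
  assumes y: "y \<in> W" and G: "\<And>j. j \<in> {1..n} \<Longrightarrow> norm (g j y) \<le> G"
    and strong: "(\<Sum>j=1..n. h j xs) / n \<ge> (\<Sum>j=1..n. h j y) / n +
      ((1 / n) *\<^sub>R (\<Sum>j=1..n. g j y)) \<bullet> (xs - y) + \<mu> / 2 * (norm (xs - y))\<^sup>2"
  shows "(\<Sum>j=1..n. (norm (g j xs))\<^sup>2) / real n \<le> 4 * (L / \<mu>) * G\<^sup>2"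
proof -
  define \<gamma> where "\<gamma> = (1 / real n) *\<^sub>R (\<Sum>j=1..n. g j y)"
  define \<Delta> where "\<Delta> = (\<Sum>j=1..n. h j y) / n - (\<Sum>j=1..n. h j xs) / n"
  have "norm (\<Sum>j=1..n. g j y) \<le> real n * G"
    using sum_norm_le[of "{1..n}" "\<lambda>j. g j y" "\<lambda>_. G"] G by simp
  then have \<gamma>: "norm \<gamma> \<le> G" using n by (simp add: \<gamma>_def field_simps)
  \<comment> \<open>Completing the square: the strong convexity bound at \<open>y\<close> is
    minimised over all displacements, which yields the Polyak-Lojasiewicz inequality.\<close>
  have "0 \<le> (norm (\<gamma> - (- \<mu>) *\<^sub>R (xs - y)))\<^sup>2" by simp
  then have "0 \<le> (norm \<gamma>)\<^sup>2 + 2 * \<mu> * (\<gamma> \<bullet> (xs - y)) + \<mu>\<^sup>2 * (norm (xs - y))\<^sup>2"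
    unfolding norm_diff_scaleR_sq by (simp add: inner_commute)
  moreover have "\<mu> * \<Delta> \<le> \<mu> * (- (\<gamma> \<bullet> (xs - y)) - \<mu> / 2 * (norm (xs - y))\<^sup>2)"
    using strong mu unfolding \<gamma>_def[symmetric] \<Delta>_def by (intro mult_left_mono) auto
  ultimately have "2 * \<mu> * \<Delta> \<le> (norm \<gamma>)\<^sup>2" by (simp add: algebra_simps power2_eq_square)
  also have "\<dots> \<le> G\<^sup>2" using \<gamma> by (intro power_mono) auto
  finally have \<Delta>: "\<Delta> \<le> G\<^sup>2 / (2 * \<mu>)" using mu by (simp add: field_simps)
  have "(\<Sum>j=1..n. (norm (g j xs))\<^sup>2) \<le> (\<Sum>j=1..n. 2 * G\<^sup>2 + 4 * L * bregman j y xs)"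
  proof (rule sum_mono)
    fix j assume j: "j \<in> {1..n}"
    have "(norm (g j xs))\<^sup>2 \<le> 2 * (norm (g j y))\<^sup>2 + 2 * (norm (g j y - g j xs))\<^sup>2"
      using norm_diff_scaleR_sq_le[of 1 "g j y" "g j y - g j xs"] by simp
    moreover have "(norm (g j y))\<^sup>2 \<le> G\<^sup>2" using G[OF j] by (intro power_mono) auto
    ultimately show "(norm (g j xs))\<^sup>2 \<le> 2 * G\<^sup>2 + 4 * L * bregman j y xs"
      using grad_diff_le_bregman[OF j y xs] by simp
  qed
  also have "\<dots> = real n * (2 * G\<^sup>2) + 4 * L * (real n * \<Delta>)"
  proof -
    have "(\<Sum>j=1..n. g j xs \<bullet> (y - xs)) = 0" using stationary by (simp flip: inner_sum_left)
    then show ?thesis using n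
      by (simp add: sum.distrib sum_subtractf \<Delta>_def right_diff_distrib flip: sum_distrib_left)
  qed
  finally have "(\<Sum>j=1..n. (norm (g j xs))\<^sup>2) / real n \<le> 2 * G\<^sup>2 + 4 * L * \<Delta>"
    using n by (simp add: field_simps)
  also have "\<dots> \<le> 2 * (L / \<mu>) * G\<^sup>2 + 4 * L * (G\<^sup>2 / (2 * \<mu>))"
  proof (intro add_mono mult_left_mono \<Delta>)
    have "1 * G\<^sup>2 \<le> (L / \<mu>) * G\<^sup>2" using mu mu_le_L by (intro mult_right_mono) auto
    then show "2 * G\<^sup>2 \<le> 2 * (L / \<mu>) * G\<^sup>2" by simp
  qed (use L in simp)
  finally show ?thesis by simp
qed

section \<open>Gradients and random permutations\<close>

lemma grad_has_derivative:
  assumes "h differentiable_on Rd d" "x \<in> Rd d"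
  shows "grad d h x \<in> Rd d" "(h has_derivative (\<lambda>v. grad d h x \<bullet> v)) (at x within Rd d)"
  using theI'[OF grad_ex1[OF assms(2)]] assms by (auto simp: differentiable_on_def grad_def)

lemma grad_eqI:
  assumes "x \<in> Rd d" "g \<in> Rd d" "(h has_derivative (\<lambda>v. g \<bullet> v)) (at x within Rd d)"
  shows "grad d h x = g"
  unfolding grad_def using assms grad_ex1[OF assms(1), of h]
  by (intro the1_equality) (auto simp: differentiable_def)

lemma grad_objective:
  assumes "\<And>j. j \<in> {1..n} \<Longrightarrow> f j differentiable_on Rd d" and x: "x \<in> Rd d"
  shows "grad d (objective n f) x = (1 / real n) *\<^sub>R (\<Sum>j=1..n. grad d (f j) x)"
proof (rule grad_eqI[OF x])
  show "(1 / real n) *\<^sub>R (\<Sum>j=1..n. grad d (f j) x) \<in> Rd d"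
    using assms grad_has_derivative(1) by (intro subspace_scale subspace_sum subspace_Rd) auto
  have "((\<lambda>x. (1 / real n) * (\<Sum>j=1..n. f j x)) has_derivative
      (\<lambda>v. (1 / real n) * (\<Sum>j=1..n. grad d (f j) x \<bullet> v))) (at x within Rd d)"
    using assms grad_has_derivative(2)
    by (intro has_derivative_mult_right has_derivative_sum) auto
  then show "(objective n f has_derivative (\<lambda>v. ((1 / real n) *\<^sub>R (\<Sum>j=1..n. grad d (f j) x)) \<bullet> v))
      (at x within Rd d)"
    by (simp add: objective_def[abs_def] inner_sum_left)
qed

text \<open>On the segment from \<open>x\<close> to \<open>y\<close> the difference quotients at
  \<open>x\<close> are at most \<open>h y - h x\<close>; their limit is the directional
  derivative.\<close>

lemma convex_above_tangent:
  assumes conv: "convex_on (Rd d) h" and diff: "h differentiable_on Rd d"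
    and x: "x \<in> Rd d" and y: "y \<in> Rd d"
  shows "h y \<ge> h x + grad d h x \<bullet> (y - x)"
proof -
  define \<phi> where "\<phi> t = h (x + t *\<^sub>R (y - x))" for t
  have in_Rd: "x + t *\<^sub>R (y - x) \<in> Rd d" for t
    using x y by (intro subspace_add subspace_scale subspace_diff subspace_Rd)
  have "((\<lambda>t. x + t *\<^sub>R (y - x)) has_derivative (\<lambda>t. t *\<^sub>R (y - x))) (at 0)"
    by (auto intro!: derivative_eq_intros)
  moreover have "(h has_derivative (\<lambda>v. grad d h x \<bullet> v))
      (at (x + 0 *\<^sub>R (y - x)) within (\<lambda>t. x + t *\<^sub>R (y - x)) ` UNIV)"
    using grad_has_derivative(2)[OF diff x] in_Rd by (auto intro: has_derivative_subset)
  ultimately have "(\<phi> has_derivative (\<lambda>t. grad d h x \<bullet> (t *\<^sub>R (y - x)))) (at 0)"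
    unfolding \<phi>_def by (rule has_derivative_in_compose)
  then have "(\<phi> has_real_derivative grad d h x \<bullet> (y - x)) (at 0)"
    by (simp add: has_field_derivative_def mult.commute[of _ "_ \<bullet> _"])
  then have "((\<lambda>t. (\<phi> t - \<phi> 0) / t) \<longlongrightarrow> grad d h x \<bullet> (y - x)) (at_right 0)"
    by (auto simp: has_field_derivative_iff intro: tendsto_within_subset)
  moreover have "\<forall>\<^sub>F t in at_right 0. (\<phi> t - \<phi> 0) / t \<le> h y - h x"
    unfolding eventually_at_right_field
  proof (intro exI[of _ 1] conjI allI impI)
    fix t :: real assume t: "0 < t" "t < 1"
    have "x + t *\<^sub>R (y - x) = (1 - t) *\<^sub>R x + t *\<^sub>R y" by (simp add: algebra_simps)
    then have "\<phi> t \<le> (1 - t) * h x + t * h y"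
      using convex_onD[OF conv, of t x y] t x y by (simp add: \<phi>_def)
    then show "(\<phi> t - \<phi> 0) / t \<le> h y - h x" using t by (simp add: \<phi>_def field_simps)
  qed simp
  ultimately have "grad d h x \<bullet> (y - x) \<le> h y - h x"
    by (rule tendsto_upperbound) simp
  then show ?thesis by simp
qed

section \<open>Splitting the process into epochs\<close>

lemma shuffle_iterate_eq_sgd_iterate:
  "shuffle_iterate d n f \<eta> \<sigma> x0 (Suc k) i =
    sgd_iterate (\<lambda>j. grad d (f j)) (\<eta> (Suc k)) (\<sigma> (Suc k)) (shuffle_iterate d n f \<eta> \<sigma> x0 (Suc k) 0) i"
  by (induction i) (simp_all add: Let_def)

lemma shuffle_iterate_cong:
  assumes "\<And>j. j \<in> {1..k} \<Longrightarrow> \<sigma> j = \<sigma>' j"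
  shows "shuffle_iterate d n f \<eta> \<sigma> x0 k i = shuffle_iterate d n f \<eta> \<sigma>' x0 k i"
  using assms
proof (induction k arbitrary: i)
  case (Suc k)
  have "shuffle_iterate d n f \<eta> \<sigma> x0 (Suc k) 0 = shuffle_iterate d n f \<eta> \<sigma>' x0 (Suc k) 0"
    using Suc by simp
  moreover have "\<sigma> (Suc k) = \<sigma>' (Suc k)" using Suc.prems by simp
  ultimately show ?case
    by (simp only: shuffle_iterate_eq_sgd_iterate[of d n f \<eta> \<sigma> x0 k i]
        shuffle_iterate_eq_sgd_iterate[of d n f \<eta> \<sigma>' x0 k i])
qed simp

lemma finite_set_random_shuffles: "finite (set_pmf (random_shuffles n K))"
proof -
  have "{\<pi>. \<pi> permutes {1..n}} \<noteq> {}" using permutes_id by blast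
  then show ?thesis unfolding random_shuffles_def
    by (subst set_Pi_pmf) (auto intro!: finite_PiE_dflt simp: set_pmf_of_set finite_permutations)
qed

text \<open>Outside \<open>{1..K}\<close> the default value is the identity, itself a permutation;
  so every outcome is a realisation covered by \<open>bounded_iterates\<close>.\<close>

lemma set_random_shuffles:
  assumes "\<sigma> \<in> set_pmf (random_shuffles n K)"
  shows "\<sigma> k permutes {1..n}"
proof -
  have "{\<pi>. \<pi> permutes {1..n}} \<noteq> {}" using permutes_id by blast
  then show ?thesis
    using assms permutes_id by (cases "k \<in> {1..K}") (auto simp: random_shuffles_def set_Pi_pmf PiE_dflt_def set_pmf_of_set finite_permutations)
qed

lemma expectation_random_shuffles_mono:
  assumes "\<And>\<sigma>. (\<And>k. \<sigma> k permutes {1..n}) \<Longrightarrow> \<phi> \<sigma> \<le> (\<psi> \<sigma> :: real)"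
  shows "measure_pmf.expectation (random_shuffles n K) \<phi> \<le> measure_pmf.expectation (random_shuffles n K) \<psi>"
  using assms set_random_shuffles
  by (intro integral_mono_AE integrable_measure_pmf_finite finite_set_random_shuffles)
    (auto simp: AE_measure_pmf_iff)

lemma expectation_random_shuffles_affine:
  fixes a b :: real
  shows "measure_pmf.expectation (random_shuffles n K) (\<lambda>\<sigma>. a * \<phi> \<sigma> + b) =
    a * measure_pmf.expectation (random_shuffles n K) \<phi> + b"
  by (simp add: integrable_measure_pmf_finite finite_set_random_shuffles)

text \<open>The permutation of the last epoch is independent of the earlier ones; exchanging the
  order of the draws makes it the inner average, with the history fixed.\<close>

lemma expectation_random_shuffles_Suc:
  "measure_pmf.expectation (random_shuffles n (Suc k)) \<phi> =
    measure_pmf.expectation (random_shuffles n k) (\<lambda>\<sigma>. perm_avg n (\<lambda>\<pi>. \<phi> (\<sigma>(Suc k := \<pi>))))"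
proof -
  let ?U = "pmf_of_set {\<pi>. \<pi> permutes {1..n}}"
  have ne: "{\<pi>. \<pi> permutes {1..n}} \<noteq> {}" using permutes_id by blast
  have fin: "finite {\<pi>. \<pi> permutes {1..n}}" by (simp add: finite_permutations)
  have "{1..Suc k} = insert (Suc k) {1..k}" by auto
  then have "random_shuffles n (Suc k) =
      bind_pmf ?U (\<lambda>\<pi>. bind_pmf (random_shuffles n k) (\<lambda>\<sigma>. return_pmf (\<sigma>(Suc k := \<pi>))))"
    unfolding random_shuffles_def by (simp add: Pi_pmf_insert')
  also have "\<dots> = bind_pmf (random_shuffles n k) (\<lambda>\<sigma>. map_pmf (\<lambda>\<pi>. \<sigma>(Suc k := \<pi>)) ?U)"
    by (subst bind_commute_pmf) (simp add: map_pmf_def)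
  finally have "measure_pmf.expectation (random_shuffles n (Suc k)) \<phi> =
     (\<Sum>\<sigma>\<in>set_pmf (random_shuffles n k). pmf (random_shuffles n k) \<sigma> *\<^sub>R
       measure_pmf.expectation (map_pmf (\<lambda>\<pi>. \<sigma>(Suc k := \<pi>)) ?U) \<phi>)"
    using finite_set_random_shuffles fin ne
    by (simp only:) (rule pmf_expectation_bind, auto simp: set_pmf_of_set)
  also have "\<dots> = (\<Sum>\<sigma>\<in>set_pmf (random_shuffles n k). pmf (random_shuffles n k) \<sigma> *\<^sub>R
       perm_avg n (\<lambda>\<pi>. \<phi> (\<sigma>(Suc k := \<pi>))))"
    using fin ne by (simp add: integral_pmf_of_set perm_avg_def card_permutations)
  also have "\<dots> = measure_pmf.expectation (random_shuffles n k) (\<lambda>\<sigma>. perm_avg n (\<lambda>\<pi>. \<phi> (\<sigma>(Suc k := \<pi>))))"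
    using finite_set_random_shuffles by (subst integral_measure_pmf) auto
  finally show ?thesis .
qed

section \<open>The convergence rate\<close>

text \<open>One fixed problem instance. The explicit constants derived here are separated into
  \<open>C\<close> and powers of \<kappa> only in the final theorem.\<close>

locale shuffle_run =
  fixes n d K :: nat and L \<mu> \<alpha> \<kappa> k0 G :: real and f :: "nat \<Rightarrow> fsvec \<Rightarrow> real"
    and \<eta> :: "nat \<Rightarrow> nat \<Rightarrow> real" and x0 xs :: fsvec and S :: "fsvec set"
  assumes n2: "n \<ge> 2" and d: "d \<ge> 1" and L_pos: "L > 0" and mu_pos: "\<mu> > 0" and alpha: "\<alpha> > 2"
    and kappa: "\<kappa> = L / \<mu>" and k0: "k0 = \<alpha> * \<kappa>"
    and f_convex: "\<And>i. i \<in> {1..n} \<Longrightarrow> convex_on (Rd d) (f i)"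
    and f_smooth: "\<And>i. i \<in> {1..n} \<Longrightarrow> f i \<in> C1L d L"
    and F_strong: "strongly_convex d \<mu> (objective n f)"
    and xs_min: "is_arg_min (objective n f) (\<lambda>x. x \<in> Rd d) xs"
    and x0: "x0 \<in> Rd d"
    and first_steps: "\<And>i. i \<in> {1..n} \<Longrightarrow> \<eta> 1 i = (2 * \<alpha> / \<mu>) / (k0 + real i)"
    and later_steps: "\<And>k i. k \<in> {2..K} \<Longrightarrow> i \<in> {1..n} \<Longrightarrow>
      \<eta> k i = (2 * \<alpha> / \<mu>) / (k0 + real n * real k)"
    and bounded: "bounded_iterates d n f \<eta> x0 S"
    and G: "G = grad_bound d n f S x0"
begin

abbreviation "g \<equiv> \<lambda>j. grad d (f j)"
abbreviation "F \<equiv> objective n f"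

section \<open>Consequences of the assumptions\<close>

lemma f_diff: "i \<in> {1..n} \<Longrightarrow> f i differentiable_on Rd d"
  using f_smooth by (auto simp: C1L_def)

lemma xs_in: "xs \<in> Rd d" using xs_min by (simp add: is_arg_min_def)

lemma grad_F: "x \<in> Rd d \<Longrightarrow> grad d F x = (1 / real n) *\<^sub>R (\<Sum>j=1..n. g j x)"
  using f_diff by (intro grad_objective) auto

lemma F_smooth:
  assumes x: "x \<in> Rd d" and y: "y \<in> Rd d"
  shows "F y \<le> F x + grad d F x \<bullet> (y - x) + L / 2 * (norm (y - x))\<^sup>2"
proof -
  have "real n * F y = (\<Sum>i=1..n. f i y)" using n2 by (simp add: objective_def)
  also have "\<dots> \<le> (\<Sum>i=1..n. f i x + g i x \<bullet> (y - x) + L / 2 * (norm (y - x))\<^sup>2)"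
    using f_smooth x y by (intro sum_mono) (auto simp: C1L_def)
  also have "\<dots> = real n * (F x + grad d F x \<bullet> (y - x) + L / 2 * (norm (y - x))\<^sup>2)"
    unfolding objective_def grad_F[OF x, unfolded objective_def] inner_scaleR_left inner_sum_left
    using n2 by (simp add: sum.distrib distrib_left)
  finally show ?thesis using n2 by (simp add: mult_le_cancel_left_pos)
qed

lemma F_strongD:
  "x \<in> Rd d \<Longrightarrow> y \<in> Rd d \<Longrightarrow> F y \<ge> F x + grad d F x \<bullet> (y - x) + \<mu> / 2 * (norm (y - x))\<^sup>2"
  using F_strong by (auto simp: strongly_convex_def)

text \<open>Both quadratic bounds are compared at 0 and a unit vector, which exists in
  \<open>Rd d\<close> because \<open>d \<ge> 1\<close>.\<close>

lemma strong_convexity_le_smoothness: "\<mu> \<le> L"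
proof -
  define u where "u = Abs_fsvec (\<lambda>j. if j = 0 then 1 else 0)"
  have cu: "coord u j = (if j = 0 then 1 else 0)" for j
    unfolding u_def by (subst coord_Abs) auto
  have "u \<in> Rd d" using d by (auto simp: Rd_def cu)
  moreover have "u \<noteq> 0" using cu[of 0] coord_zero[of 0] by auto
  moreover have "0 \<in> Rd d" by (rule subspace_0[OF subspace_Rd])
  ultimately have "\<mu> / 2 * (norm u)\<^sup>2 \<le> L / 2 * (norm u)\<^sup>2"
    using F_smooth[of 0 u, unfolded diff_0_right] F_strongD[of 0 u, unfolded diff_0_right] by linarith
  then show ?thesis using \<open>u \<noteq> 0\<close> by (simp add: mult_le_cancel_right)
qed

text \<open>A gradient step of length \<open>1 / L\<close> from the minimiser would lower
  \<open>F\<close> by at least \<open>(norm \<gamma>)\<^sup>2 / (2 * L)\<close>.\<close>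

lemma grad_F_xs: "grad d F xs = 0"
proof -
  define \<gamma> where "\<gamma> = grad d F xs"
  have \<gamma>: "\<gamma> \<in> Rd d" unfolding \<gamma>_def grad_F[OF xs_in]
    using f_diff xs_in by (intro subspace_scale subspace_sum subspace_Rd grad_has_derivative(1)) auto
  define y where "y = xs - (1 / L) *\<^sub>R \<gamma>"
  have y: "y \<in> Rd d" unfolding y_def
    using \<gamma> xs_in by (intro subspace_diff subspace_scale subspace_Rd)
  have "F xs \<le> F y" using xs_min y by (auto simp: is_arg_min_def not_less)
  also have "\<dots> \<le> F xs + \<gamma> \<bullet> (y - xs) + L / 2 * (norm (y - xs))\<^sup>2"
    using F_smooth[OF xs_in y] by (simp add: \<gamma>_def)
  also have "\<gamma> \<bullet> (y - xs) = - ((norm \<gamma>)\<^sup>2 / L)"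
    by (simp add: y_def power2_norm_eq_inner)
  also have "(norm (y - xs))\<^sup>2 = (norm \<gamma>)\<^sup>2 / L\<^sup>2"
    by (simp add: y_def power_divide power_mult_distrib)
  also have "L / 2 * ((norm \<gamma>)\<^sup>2 / L\<^sup>2) = (norm \<gamma>)\<^sup>2 / L / 2"
    using L_pos by (simp add: power2_eq_square)
  finally have "(norm \<gamma>)\<^sup>2 / L \<le> 0" by simp
  then show ?thesis using L_pos by (simp add: divide_le_0_iff \<gamma>_def)
qed

sublocale convex_finite_sum "Rd d" n f g L \<mu> xs
proof
  show "(\<Sum>j=1..n. g j xs) = 0" using grad_F_xs grad_F[OF xs_in] n2 by simp
  show "(\<Sum>j=1..n. f j y) / real n \<ge> (\<Sum>j=1..n. f j xs) / real n + \<mu> / 2 * (norm (y - xs))\<^sup>2"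
    if "y \<in> Rd d" for y
    using F_strongD[OF xs_in that] grad_F_xs by (simp add: objective_def)
qed (use n2 L_pos mu_pos strong_convexity_le_smoothness xs_in f_diff f_smooth f_convex convex_above_tangent
      grad_has_derivative(1) subspace_Rd in \<open>auto simp: C1L_def\<close>)

lemma kappa_ge_1: "\<kappa> \<ge> 1"
  using mu mu_le_L by (simp add: kappa)

lemma k0_bounds: "\<alpha> \<le> k0" "k0 > 2"
proof -
  show "\<alpha> \<le> k0" using mult_left_mono[OF kappa_ge_1, of \<alpha>] alpha by (simp add: k0)
  then show "k0 > 2" using alpha by simp
qed

text \<open>The supremum defining \<open>G\<close> bounds its members only if the family is bounded
  above; this holds since the hull is bounded and the gradients are Lipschitz.\<close>

lemma grad_le_G:
  assumes j: "j \<in> {1..n}" and x: "x \<in> insert x0 S"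
  shows "norm (g j x) \<le> G"
proof -
  define H where "H = convex hull (S \<union> {x0})"
  have S: "compact S" "S \<subseteq> Rd d" using bounded by (auto simp: bounded_iterates_def)
  have H: "H \<subseteq> Rd d"
    unfolding H_def using S x0 by (intro hull_minimal subspace_imp_convex subspace_Rd) auto
  have "Elementary_Metric_Spaces.bounded H"
    unfolding H_def using S compact_imp_bounded by (intro bounded_convex_hull) auto
  then obtain b where b: "\<And>y. y \<in> H \<Longrightarrow> norm (y - x0) \<le> b"
    using bounded_any_center[of H x0] by (auto simp: dist_norm norm_minus_commute)
  have "bdd_above ((\<lambda>(i, x). norm (g i x)) ` ({1..n} \<times> H))"
  proof (rule bdd_aboveI2)
    fix p assume p: "p \<in> {1..n} \<times> H"
    obtain i y where iy: "p = (i, y)" "i \<in> {1..n}" "y \<in> H" using p by auto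
    have "norm (g i y) \<le> norm (g i x0) + norm (g i y - g i x0)" by (metis norm_triangle_sub)
    also have "norm (g i x0) \<le> (\<Sum>i=1..n. norm (g i x0))"
      using iy by (intro member_le_sum) auto
    also have "norm (g i y - g i x0) \<le> L * norm (y - x0)"
      using iy H x0 by (intro grad_lipschitz) auto
    also have "\<dots> \<le> L * b" using b[OF iy(3)] L by (intro mult_left_mono) auto
    finally show "(case p of (i, x) \<Rightarrow> norm (g i x)) \<le> (\<Sum>i=1..n. norm (g i x0)) + L * b"
      by (simp add: iy)
  qed
  moreover have "(j, x) \<in> {1..n} \<times> H" using j x by (auto simp: H_def intro: hull_inc)
  ultimately have "(case (j, x) of (i, x) \<Rightarrow> norm (g i x)) \<le> (SUP (i, x)\<in>{1..n} \<times> H. norm (g i x))"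
    by (rule cSUP_upper[rotated])
  then show ?thesis by (simp add: G grad_bound_def H_def)
qed

lemma variance_le: "(\<Sum>j=1..n. (norm (g j xs))\<^sup>2) / real n \<le> 4 * \<kappa> * G\<^sup>2"
  unfolding kappa using F_strongD[OF x0 xs_in] grad_F[OF x0]
  by (intro gradient_variance_le[OF x0]) (auto simp: objective_def intro: grad_le_G)

text \<open>The point reached after \<open>k\<close> epochs, that is, the initial point of epoch
  \<open>Suc k\<close>; it depends only on the first \<open>k\<close> permutations.\<close>

definition start :: "(nat \<Rightarrow> nat \<Rightarrow> nat) \<Rightarrow> nat \<Rightarrow> fsvec" where
  "start \<sigma> k = shuffle_iterate d n f \<eta> \<sigma> x0 (Suc k) 0"

lemma start_cong: "(\<And>j. j \<in> {1..k} \<Longrightarrow> \<sigma> j = \<sigma>' j) \<Longrightarrow> start \<sigma> k = start \<sigma>' k"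
  unfolding start_def shuffle_iterate.simps(2) by (rule shuffle_iterate_cong)

lemma start_0: "start \<sigma> 0 = x0"
  by (simp add: start_def)

lemma start_Suc: "start (\<sigma>(Suc k := \<pi>)) (Suc k) = sgd_iterate g (\<eta> (Suc k)) \<pi> (start \<sigma> k) n"
proof -
  have "start (\<sigma>(Suc k := \<pi>)) (Suc k) = shuffle_iterate d n f \<eta> (\<sigma>(Suc k := \<pi>)) x0 (Suc k) n"
    by (simp add: start_def)
  also have "\<dots> = sgd_iterate g (\<eta> (Suc k)) \<pi> (start (\<sigma>(Suc k := \<pi>)) k) n"
    by (simp only: shuffle_iterate_eq_sgd_iterate[of d n f \<eta> "\<sigma>(Suc k := \<pi>)" x0 k n] start_def fun_upd_same)
  also have "start (\<sigma>(Suc k := \<pi>)) k = start \<sigma> k"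
    by (rule start_cong) auto
  finally show ?thesis .
qed

text \<open>Position 0 of an epoch is the last iterate of the previous one, or \<open>x0\<close> in
  the first epoch; hence the inserted point.\<close>

lemma iterate_in:
  assumes \<sigma>: "\<And>k. \<sigma> k permutes {1..n}" and i: "i \<le> n"
  shows "shuffle_iterate d n f \<eta> \<sigma> x0 (Suc k) i \<in> insert x0 S"
proof -
  have S: "shuffle_iterate d n f \<eta> \<sigma> x0 (Suc k) i \<in> S" if "i \<in> {1..n}" for k i
    using \<sigma> bounded that unfolding bounded_iterates_def by (metis le_add1 plus_1_eq_Suc)
  show ?thesis
  proof (cases "i = 0")
    case True
    then show ?thesis using S[of n] n2 by (cases k) (simp_all del: shuffle_iterate.simps(3))
  qed (use S i in simp)
qed

section \<open>The mean squared error after each epoch\<close>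

abbreviation T :: "nat \<Rightarrow> real" where
  "T k \<equiv> k0 + real n * real k"

lemma step_le: "t \<ge> k0 \<Longrightarrow> 0 \<le> (2 * \<alpha> / \<mu>) / t \<and> (2 * \<alpha> / \<mu>) / t \<le> 2 / L"
  using k0_bounds alpha mu L by (auto simp: k0 kappa field_simps)

lemma epoch:
  assumes \<sigma>: "\<And>k. \<sigma> k permutes {1..n}" and k: "k < K"
  shows "shuffle_epoch (Rd d) n f g L \<mu> xs (\<eta> (Suc k)) (start \<sigma> k) G"
proof unfold_locales
  have "x0 \<in> Rd d" "S \<subseteq> Rd d" using x0 bounded by (auto simp: bounded_iterates_def)
  then show "start \<sigma> k \<in> Rd d" using iterate_in[of \<sigma> 0 k, OF \<sigma>] by (auto simp: start_def)
  show "0 \<le> \<eta> (Suc k) i \<and> \<eta> (Suc k) i \<le> 2 / L" if i: "i \<in> {1..n}" for i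
  proof (cases k)
    case 0
    then show ?thesis using first_steps[OF i] step_le[of "k0 + real i"] by simp
  next
    case (Suc m)
    then show ?thesis using later_steps[OF _ i, of "Suc k"] k step_le[of "T (Suc k)"] by simp
  qed
  fix \<pi> :: "nat \<Rightarrow> nat" and i j assume \<pi>: "\<pi> permutes {1..n}" and i: "i \<le> n" and j: "j \<in> {1..n}"
  \<comment> \<open>Replacing the current permutation by any other one gives again a realisation of
    the process, so boundedness applies to every \<open>\<pi>\<close>.\<close>
  have "start \<sigma> k = start (\<sigma>(Suc k := \<pi>)) k" by (rule start_cong) auto
  then have "sgd_iterate g (\<eta> (Suc k)) \<pi> (start \<sigma> k) i = shuffle_iterate d n f \<eta> (\<sigma>(Suc k := \<pi>)) x0 (Suc k) i"
    by (simp only: shuffle_iterate_eq_sgd_iterate[of d n f \<eta> "\<sigma>(Suc k := \<pi>)" x0 k i] start_def fun_upd_same)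
  also have "\<dots> \<in> insert x0 S"
    using \<sigma> \<pi> i by (intro iterate_in) auto
  finally show "norm (g j (sgd_iterate g (\<eta> (Suc k)) \<pi> (start \<sigma> k) i)) \<le> G"
    using grad_le_G[OF j] by blast
qed

text \<open>Only the first \<open>k\<close> permutations are drawn, so that one more epoch is one
  more independent draw.\<close>

definition mse :: "nat \<Rightarrow> real" where
  "mse k = measure_pmf.expectation (random_shuffles n k) (\<lambda>\<sigma>. (norm (start \<sigma> k - xs))\<^sup>2)"

lemma mse_0: "mse 0 = (norm (x0 - xs))\<^sup>2"
  by (simp add: mse_def start_0)

lemma mse_Suc_le:
  assumes "\<And>\<sigma>. (\<And>k. \<sigma> k permutes {1..n}) \<Longrightarrow>
    perm_avg n (\<lambda>\<pi>. (norm (sgd_iterate g (\<eta> (Suc k)) \<pi> (start \<sigma> k) n - xs))\<^sup>2) \<le>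
      a * (norm (start \<sigma> k - xs))\<^sup>2 + b"
  shows "mse (Suc k) \<le> a * mse k + b"
proof -
  have "mse (Suc k) = measure_pmf.expectation (random_shuffles n k)
      (\<lambda>\<sigma>. perm_avg n (\<lambda>\<pi>. (norm (sgd_iterate g (\<eta> (Suc k)) \<pi> (start \<sigma> k) n - xs))\<^sup>2))"
    unfolding mse_def expectation_random_shuffles_Suc start_Suc ..
  also have "\<dots> \<le> measure_pmf.expectation (random_shuffles n k) (\<lambda>\<sigma>. a * (norm (start \<sigma> k - xs))\<^sup>2 + b)"
    using assms by (rule expectation_random_shuffles_mono)
  also have "\<dots> = a * mse k + b"
    unfolding mse_def by (rule expectation_random_shuffles_affine)
  finally show ?thesis .
qed

abbreviation "Q \<equiv> G\<^sup>2 / L\<^sup>2"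
abbreviation "R \<equiv> (norm (x0 - xs))\<^sup>2"

lemma mse_large_steps: "k \<le> K \<Longrightarrow> mse k \<le> R + real n * real k * (20 * Q)"
proof (induction k)
  case (Suc k)
  have "mse (Suc k) \<le> 1 * mse k + real n * (20 * Q)"
  proof (rule mse_Suc_le)
    fix \<sigma> :: "nat \<Rightarrow> nat \<Rightarrow> nat" assume "\<And>k. \<sigma> k permutes {1..n}"
    then interpret shuffle_epoch "Rd d" n f g L \<mu> xs "\<eta> (Suc k)" "start \<sigma> k" G
      using Suc.prems by (intro epoch) auto
    show "perm_avg n (\<lambda>\<pi>. (norm (sgd_iterate g (\<eta> (Suc k)) \<pi> (start \<sigma> k) n - xs))\<^sup>2) \<le>
        1 * (norm (start \<sigma> k - xs))\<^sup>2 + real n * (20 * Q)"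
      using perm_avg_large_steps[of n] by simp
  qed
  moreover have "mse k \<le> R + real n * real k * (20 * Q)" using Suc by simp
  moreover have "real n * real (Suc k) * (20 * Q) = real n * real k * (20 * Q) + real n * (20 * Q)"
    by (simp only: of_nat_Suc distrib_left distrib_right mult_1_right mult_1_left)
  ultimately show ?case by linarith
qed (simp add: mse_0)

lemma mse_first_epoch:
  assumes K: "K \<ge> 1" and large: "64 * k0 \<le> T 1"
  shows "mse 1 \<le> 163904 * (\<alpha> ^ 3 * \<kappa> ^ 4 * Q) / T 1 + 2 * (R * (65 * k0) powr \<alpha>) / (T 1 + 1) powr \<alpha>"
proof -
  \<comment> \<open>The process starts at the fixed point \<open>x0\<close>, so its squared distance
    goes into the additive term and the factor is 0.\<close>
  have "mse (Suc 0) \<le> 0 * mse 0 + (163904 * (\<alpha> ^ 3 * \<kappa> ^ 4 * Q) / T 1 +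
      2 * (R * (65 * k0) powr \<alpha>) / (T 1 + 1) powr \<alpha>)"
  proof (rule mse_Suc_le)
    fix \<sigma> :: "nat \<Rightarrow> nat \<Rightarrow> nat" assume "\<And>k. \<sigma> k permutes {1..n}"
    then interpret shuffle_epoch "Rd d" n f g L \<mu> xs "\<eta> (Suc 0)" "start \<sigma> 0" G
      using K by (intro epoch) auto
    show "perm_avg n (\<lambda>\<pi>. (norm (sgd_iterate g (\<eta> (Suc 0)) \<pi> (start \<sigma> 0) n - xs))\<^sup>2) \<le>
        0 * (norm (start \<sigma> 0 - xs))\<^sup>2 + (163904 * (\<alpha> ^ 3 * \<kappa> ^ 4 * Q) / T 1 +
        2 * (R * (65 * k0) powr \<alpha>) / (T 1 + 1) powr \<alpha>)"
      using perm_avg_first_epoch[OF alpha kappa k0 refl _ variance_le] first_steps large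
      by (simp add: start_0)
  qed
  then show ?thesis by simp
qed

lemma mse_later_epoch:
  assumes k: "1 \<le> k" "k < K" and large: "64 * k0 \<le> T (Suc k)"
  defines "t \<equiv> T (Suc k)"
  shows "mse (Suc k) \<le> (1 - 29 / 16 * \<alpha> / t) ^ n * mse k + 3200 * (\<alpha> ^ 3 * \<kappa> ^ 4 * Q) * (real n)\<^sup>2 / t ^ 3"
proof (rule mse_Suc_le)
  fix \<sigma> :: "nat \<Rightarrow> nat \<Rightarrow> nat" assume "\<And>k. \<sigma> k permutes {1..n}"
  then interpret shuffle_epoch "Rd d" n f g L \<mu> xs "\<eta> (Suc k)" "start \<sigma> k" G
    using k by (intro epoch) auto
  define e where "e = (2 * \<alpha> / \<mu>) / t"
  have t: "t > 0" using k0_bounds large unfolding t_def by linarith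
  have eL: "e * L = 2 * (\<alpha> * \<kappa>) / t" and emu: "e * \<mu> = 2 * \<alpha> / t"
    using mu by (simp_all add: e_def kappa)
  have e: "e = 2 * (\<alpha> * \<kappa>) / (L * t)" using L mu by (simp add: e_def kappa)
  have "perm_avg n (\<lambda>\<pi>. (norm (X \<pi> n - xs))\<^sup>2) \<le> (1 - 29 / 32 * (e * \<mu>)) ^ n * (norm (start \<sigma> k - xs))\<^sup>2 +
    real n * (96 * (e * L) * (real n * (e\<^sup>2 * (4 * \<kappa> * G\<^sup>2))) + 16 * (e * L) * (e * G)\<^sup>2)"
  proof (rule perm_avg_constant_step_epoch[OF _ _ variance_le])
    show "\<eta> (Suc k) i = e" if "i \<in> {1..n}" for i
      using later_steps[OF _ that, of "Suc k"] k by (simp add: e_def t_def)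
    have "64 * k0 \<le> t" using large by (simp only: t_def)
    then show "e * L \<le> 1 / 32" using t unfolding eL k0 by (simp add: field_simps)
  qed
  also have "29 / 32 * (e * \<mu>) = 29 / 16 * \<alpha> / t" by (simp add: emu)
  also have "real n * (96 * (e * L) * (real n * (e\<^sup>2 * (4 * \<kappa> * G\<^sup>2))) + 16 * (e * L) * (e * G)\<^sup>2) \<le>
      3200 * (\<alpha> ^ 3 * \<kappa> ^ 4 * Q) * (real n)\<^sup>2 / t ^ 3"
  proof -
    \<comment> \<open>Here \<kappa> occurs squared from the step size and once from the variance
      bound; the factor \<open>e * L\<close> supplies the fourth.\<close>
    have e2: "e\<^sup>2 * (4 * \<kappa> * G\<^sup>2) = 16 * (\<alpha>\<^sup>2 * \<kappa> ^ 3 * Q) / t\<^sup>2"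
      by (simp add: e power_mult_distrib power_divide power2_eq_square power3_eq_cube mult_ac)
    have 1: "96 * (e * L) * (real n * (e\<^sup>2 * (4 * \<kappa> * G\<^sup>2))) = 3072 * (\<alpha> ^ 3 * \<kappa> ^ 4 * Q) * real n / t ^ 3"
      unfolding e2 eL by (simp add: power2_eq_square power3_eq_cube power4_eq_xxxx mult_ac)
    have eG: "(e * G)\<^sup>2 = 4 * (\<alpha>\<^sup>2 * \<kappa>\<^sup>2 * Q) / t\<^sup>2"
      by (simp add: e power_mult_distrib power_divide)
    have "16 * (e * L) * (e * G)\<^sup>2 = 128 * (\<alpha> ^ 3 * \<kappa> ^ 3 * Q) * 1 / t ^ 3"
      unfolding eG eL by (simp add: power2_eq_square power3_eq_cube mult_ac)
    also have "\<dots> \<le> 128 * (\<alpha> ^ 3 * \<kappa> ^ 4 * Q) * real n / t ^ 3"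
      using kappa_ge_1 alpha t n
      by (intro divide_right_mono mult_mono mult_left_mono mult_right_mono power_increasing) auto
    finally have "96 * (e * L) * (real n * (e\<^sup>2 * (4 * \<kappa> * G\<^sup>2))) + 16 * (e * L) * (e * G)\<^sup>2 \<le>
        3200 * (\<alpha> ^ 3 * \<kappa> ^ 4 * Q) * real n / t ^ 3"
      unfolding 1 by (simp add: add_divide_distrib[symmetric])
    from mult_left_mono[OF this, of "real n"] show ?thesis by (simp add: power2_eq_square mult_ac)
  qed
  finally show "perm_avg n (\<lambda>\<pi>. (norm (sgd_iterate g (\<eta> (Suc k)) \<pi> (start \<sigma> k) n - xs))\<^sup>2) \<le>
      (1 - 29 / 16 * \<alpha> / t) ^ n * (norm (start \<sigma> k - xs))\<^sup>2 +
      3200 * (\<alpha> ^ 3 * \<kappa> ^ 4 * Q) * (real n)\<^sup>2 / t ^ 3" by simp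
qed

text \<open>The denominators are shifted by \<open>n\<close>: \<open>T k + n\<close> is
  \<open>T (Suc k)\<close>, the denominator of the next step size, as
  \<open>late_epoch_recursion\<close> requires. The constant in \<open>B\<close> is
  \<open>64 * 20 * 128\<^sup>2\<close>, and 130 is twice the 65 of the first epoch.\<close>

lemma mse_bound:
  assumes "1 \<le> k" "k \<le> K"
  defines "B \<equiv> 20971520 * (\<alpha> ^ 3 * \<kappa> ^ 4 * Q)" and "P \<equiv> 2 * (R * (130 * k0) powr \<alpha>)"
  shows "mse k \<le> B * n / (T k + n)\<^sup>2 + P / (T k + n) powr \<alpha>"
  using assms(1,2)
proof (induction k rule: dec_induct)
  have B0: "B \<ge> 0" and P0: "P \<ge> 0" using alpha kappa_ge_1 by (auto simp: B_def P_def)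
  have n0: "real n > 0" using n2 by simp
  \<comment> \<open>As long as \<open>T k \<le> 64 * k0\<close>, growth without contraction
    suffices; \<open>k \<ge> 1\<close> gives \<open>T k + n \<le> 128 * k0\<close>.\<close>
  have early: "mse k \<le> B * n / (T k + n)\<^sup>2 + P / (T k + n) powr \<alpha>"
    if k: "1 \<le> k" "k \<le> K" and small: "T k \<le> 64 * k0" for k
  proof -
    have "real n * 1 \<le> real n * real k" using k by (intro mult_left_mono) auto
    then have Tn: "0 < T k + n" "T k + n \<le> 128 * k0" using small k0_bounds by auto
    have "R \<le> P / (T k + n) powr \<alpha>"
    proof -
      have "(T k + n) powr \<alpha> \<le> (130 * k0) powr \<alpha>"
        using Tn k0_bounds alpha by (intro powr_mono2) auto
      then have "R * (T k + n) powr \<alpha> \<le> P"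
        unfolding P_def by (smt (verit) mult_left_mono zero_le_power2 mult_nonneg_nonneg powr_ge_zero)
      then show ?thesis using Tn by (simp add: le_divide_eq)
    qed
    moreover have "real n * real k * (20 * Q) \<le> B * n / (T k + n)\<^sup>2"
    proof -
      have "real n * real k * (20 * Q) \<le> (64 * k0) * (20 * Q)"
        using small k0_bounds by (intro mult_right_mono) auto
      moreover have "(T k + n)\<^sup>2 \<le> (128 * k0)\<^sup>2" using Tn by (intro power_mono) auto
      ultimately have "real n * real k * (20 * Q) * (T k + n)\<^sup>2 \<le> (64 * k0) * (20 * Q) * (128 * k0)\<^sup>2"
        by (rule mult_mono) (use k0_bounds in auto)
      also have "\<dots> = 20971520 * (\<alpha> ^ 3 * \<kappa> ^ 3 * Q)"
        by (simp add: k0 power2_eq_square power3_eq_cube)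
      also have "\<dots> \<le> B * 1" unfolding B_def
        using alpha kappa_ge_1 by (simp, intro mult_left_mono mult_right_mono divide_right_mono power_increasing) auto
      also have "\<dots> \<le> B * n" using B0 n by (intro mult_left_mono) auto
      finally show ?thesis using Tn by (simp add: le_divide_eq)
    qed
    ultimately show ?thesis using mse_large_steps[OF k(2)] by simp
  qed
  {
    case base
    show ?case
    proof (cases "T 1 \<le> 64 * k0")
      case True
      then show ?thesis using assms by (intro early) auto
    next
      case False
      define t where "t = T 1"
      define Z where "Z = \<alpha> ^ 3 * \<kappa> ^ 4 * Q"
      have Z0: "Z \<ge> 0" using alpha kappa_ge_1 by (simp add: Z_def)
      \<comment> \<open>Here \<open>n\<close> exceeds \<open>63 * k0\<close>, so \<open>t\<close>
        and \<open>n\<close> are comparable and the first epoch's \<open>1 / t\<close> has the order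
        \<open>n / t\<^sup>2\<close>.\<close>
      have t: "t > 64 * k0" "t > 0" "t \<le> 64 / 63 * n" using False k0_bounds by (auto simp: t_def)
      have tn: "t + n \<le> 2 * (t + 1)" "t + n \<le> 2 * t" using k0_bounds by (auto simp: t_def)
      have "163904 * Z / t \<le> B * n / (t + n)\<^sup>2"
      proof -
        have "163904 * Z * (t + n)\<^sup>2 \<le> 163904 * Z * (2 * t)\<^sup>2"
          using tn t Z0 by (intro mult_left_mono power_mono) auto
        also have "\<dots> = (655616 * Z * t) * t" by (simp add: power2_eq_square)
        also have "\<dots> \<le> (655616 * Z * t) * (64 / 63 * n)" using t Z0 by (intro mult_left_mono) auto
        also have "\<dots> \<le> B * n * t" using t Z0 n0 unfolding B_def Z_def[symmetric] by simp
        finally show ?thesis using t n0 by (simp add: divide_simps mult_ac)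
      qed
      moreover have "2 * (R * (65 * k0) powr \<alpha>) / (t + 1) powr \<alpha> \<le> P / (t + n) powr \<alpha>"
      proof -
        have "(65 * k0) powr \<alpha> * (t + n) powr \<alpha> \<le> (65 * k0) powr \<alpha> * (2 * (t + 1)) powr \<alpha>"
          using tn t alpha k0_bounds by (intro mult_left_mono powr_mono2) auto
        also have "\<dots> = (130 * k0) powr \<alpha> * (t + 1) powr \<alpha>"
          using t k0_bounds by (simp flip: powr_mult add: algebra_simps)
        finally have "(65 * k0) powr \<alpha> / (t + 1) powr \<alpha> \<le> (130 * k0) powr \<alpha> / (t + n) powr \<alpha>"
          using t n0 by (simp add: divide_simps)
        from mult_left_mono[OF this, of "2 * R"] show ?thesis by (simp add: P_def mult.assoc)
      qed
      moreover have "mse 1 \<le> 163904 * Z / t + 2 * (R * (65 * k0) powr \<alpha>) / (t + 1) powr \<alpha>"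
        using mse_first_epoch assms False unfolding t_def Z_def by simp
      ultimately show ?thesis unfolding t_def by linarith
    qed
  next
    case (step k)
    show ?case
    proof (cases "T (Suc k) \<le> 64 * k0")
      case True
      then show ?thesis using step by (intro early) auto
    next
      case False
      define t where "t = T (Suc k)"
      define Z where "Z = \<alpha> ^ 3 * \<kappa> ^ 4 * Q"
      have Z0: "Z \<ge> 0" using alpha kappa_ge_1 by (simp add: Z_def)
      have t: "t > 64 * k0" "T k + n = t" using False by (auto simp: t_def algebra_simps)
      \<comment> \<open>From the second epoch on, the denominator is at least \<open>2 * n\<close>;
        this is what keeps the quotient \<open>q\<close> above \<open>2 / 3\<close>.\<close>
      have t2: "2 * real n \<le> t"
        using step mult_left_mono[of 2 "real (Suc k)" "real n"] k0_bounds by (simp add: t_def)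
      have t0: "t > 0" using t k0_bounds by simp
      have \<rho>: "0 \<le> 1 - 29 / 16 * \<alpha> / t" using t k0_bounds t0 by (simp add: field_simps)
      have "mse (Suc k) \<le> (1 - 29 / 16 * \<alpha> / t) ^ n * mse k + 3200 * Z * (real n)\<^sup>2 / t ^ 3"
        using mse_later_epoch[of k] step False unfolding t_def Z_def by simp
      also have "(1 - 29 / 16 * \<alpha> / t) ^ n * mse k \<le>
          (1 - 29 / 16 * \<alpha> / t) ^ n * (B * n / t\<^sup>2 + P / t powr \<alpha>)"
        using step \<rho> t(2) by (intro mult_left_mono) auto
      also have "\<dots> + 3200 * Z * (real n)\<^sup>2 / t ^ 3 \<le> B * n / (t + n)\<^sup>2 + P / (t + n) powr \<alpha>"
      proof (rule late_epoch_recursion[OF n t2 _ _ _ B0 P0 \<rho>])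
        show "3 / 2 * \<alpha> \<le> t" using t k0_bounds by simp
        show "4 * (3200 * Z) \<le> B" using Z0 unfolding B_def Z_def[symmetric] by simp
        show "1 - 29 / 16 * \<alpha> / t \<le> 1 - 3 / 2 * \<alpha> / t" using t0 alpha by (simp add: field_simps)
      qed (use alpha in simp)
      finally show ?thesis by (simp add: t_def)
    qed
  }
qed

lemma expectation_bound:
  assumes K: "K \<ge> 1"
  shows "measure_pmf.expectation (random_shuffles n K)
      (\<lambda>\<sigma>. F (shuffle_iterate d n f \<eta> \<sigma> x0 (K + 1) 0)) - F xs \<le>
    (L / 2 * (20971520 * (\<alpha> ^ 3 * \<kappa> ^ 4 * Q))) * n / (T K)\<^sup>2 +
    (L * ((130 * k0) powr \<alpha>)) * R / (T K) powr \<alpha>"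
proof -
  define B where "B = 20971520 * (\<alpha> ^ 3 * \<kappa> ^ 4 * Q)"
  define P where "P = 2 * (R * (130 * k0) powr \<alpha>)"
  have B0: "B \<ge> 0" and P0: "P \<ge> 0" using alpha kappa_ge_1 by (auto simp: B_def P_def)
  define t where "t = T K"
  have t: "t > 0" using k0_bounds by (simp add: t_def add_pos_nonneg)
  have "measure_pmf.expectation (random_shuffles n K) (\<lambda>\<sigma>. F (start \<sigma> K)) \<le>
      measure_pmf.expectation (random_shuffles n K) (\<lambda>\<sigma>. L / 2 * (norm (start \<sigma> K - xs))\<^sup>2 + F xs)"
  proof (rule expectation_random_shuffles_mono)
    fix \<sigma> :: "nat \<Rightarrow> nat \<Rightarrow> nat" assume "\<And>k. \<sigma> k permutes {1..n}"
    then have "start \<sigma> K \<in> insert x0 S" unfolding start_def by (intro iterate_in) auto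
    then have "start \<sigma> K \<in> Rd d" using x0 bounded by (auto simp: bounded_iterates_def)
    then show "F (start \<sigma> K) \<le> L / 2 * (norm (start \<sigma> K - xs))\<^sup>2 + F xs"
      using F_smooth[OF xs_in] grad_F_xs by fastforce
  qed
  also have "\<dots> = L / 2 * mse K + F xs"
    unfolding mse_def by (rule expectation_random_shuffles_affine)
  also have "L / 2 * mse K \<le> L / 2 * (B * n / t\<^sup>2 + P / t powr \<alpha>)"
  proof (rule mult_left_mono)
    have "mse K \<le> B * n / (t + n)\<^sup>2 + P / (t + n) powr \<alpha>"
      using mse_bound[of K] K unfolding B_def P_def t_def by simp
    \<comment> \<open>The shift by \<open>n\<close>, needed for the induction over epochs, is
      dropped.\<close>
    also have "\<dots> \<le> B * n / t\<^sup>2 + P / t powr \<alpha>"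
      using B0 P0 t alpha by (intro add_mono divide_left_mono power_mono powr_mono2 mult_pos_pos) auto
    finally show "mse K \<le> B * n / t\<^sup>2 + P / t powr \<alpha>" .
  qed (use L in simp)
  also have "L / 2 * (B * n / t\<^sup>2 + P / t powr \<alpha>) =
      (L / 2 * B) * n / t\<^sup>2 + (L * ((130 * k0) powr \<alpha>)) * R / t powr \<alpha>"
    by (simp add: P_def distrib_left mult_ac)
  finally show ?thesis by (simp add: start_def B_def t_def)
qed

end

theorem theorem3:
  "\<exists>C :: real \<Rightarrow> real \<Rightarrow> real \<Rightarrow> real.
    \<forall>(n :: nat) (d :: nat) (K :: nat) (L :: real) (\<mu> :: real) (\<alpha> :: real) (\<kappa> :: real) (k\<^sub>0 :: real)
      (G :: real) (f :: nat \<Rightarrow> fsvec \<Rightarrow> real) (F :: fsvec \<Rightarrow> real) (\<eta> :: nat \<Rightarrow> nat \<Rightarrow> real)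
      (x\<^sub>0 :: fsvec) (xstar :: fsvec) (S :: fsvec set).
      n \<ge> 2 \<and> d \<ge> 1 \<and> K \<ge> 1 \<and> L > 0 \<and> \<mu> > 0 \<and> \<alpha> > 2 \<and>
      \<kappa> = L / \<mu> \<and> k\<^sub>0 = \<alpha> * \<kappa> \<and> F = objective n f \<and>
      (\<forall>i\<in>{1..n}. convex_on (Rd d) (f i) \<and> f i \<in> C1L d L) \<and>
      strongly_convex d \<mu> F \<and>
      is_arg_min F (\<lambda>x. x \<in> Rd d) xstar \<and>
      x\<^sub>0 \<in> Rd d \<and>
      (\<forall>i\<in>{1..n}. \<eta> 1 i = (2 * \<alpha> / \<mu>) / (k\<^sub>0 + real i)) \<and>
      (\<forall>k\<in>{2..K}. \<forall>i\<in>{1..n}. \<eta> k i = (2 * \<alpha> / \<mu>) / (k\<^sub>0 + real n * real k)) \<and>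
      bounded_iterates d n f \<eta> x\<^sub>0 S \<and>
      G = grad_bound d n f S x\<^sub>0
      \<longrightarrow>
      (\<exists>c\<^sub>1 c\<^sub>2 :: real.
        c\<^sub>1 \<le> C L G \<alpha> * \<kappa> ^ 4 \<and>
        c\<^sub>2 \<le> C L G \<alpha> * \<kappa> powr \<alpha> \<and>
        measure_pmf.expectation (random_shuffles n K)
          (\<lambda>\<sigma>. F (shuffle_iterate d n f \<eta> \<sigma> x\<^sub>0 (K + 1) 0)) - F xstar
        \<le> c\<^sub>1 * real n / (k\<^sub>0 + real n * real K)\<^sup>2
          + c\<^sub>2 * (norm (x\<^sub>0 - xstar))\<^sup>2 / (k\<^sub>0 + real n * real K) powr \<alpha>)"
\<comment> \<open>One function \<open>C\<close> has to serve both coefficients, so it is the sum of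
  their factors after splitting off \<open>\<kappa> ^ 4\<close> and
  \<open>\<kappa> powr \<alpha>\<close>; both summands are nonnegative.\<close>
proof (rule exI[of _ "\<lambda>L G \<alpha>. L / 2 * (20971520 * (\<alpha> ^ 3 * (G\<^sup>2 / L\<^sup>2))) + L * (130 * \<alpha>) powr \<alpha>"],
    intro allI impI, elim conjE)
  fix n d K :: nat and L \<mu> \<alpha> \<kappa> k0 G :: real and f :: "nat \<Rightarrow> fsvec \<Rightarrow> real" and F :: "fsvec \<Rightarrow> real"
    and \<eta> :: "nat \<Rightarrow> nat \<Rightarrow> real" and x0 xs :: fsvec and S :: "fsvec set"
  assume K: "K \<ge> 1" and F: "F = objective n f" and as: "n \<ge> 2" "d \<ge> 1" "L > 0" "\<mu> > 0" "\<alpha> > 2"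
      "\<kappa> = L / \<mu>" "k0 = \<alpha> * \<kappa>"
      "\<forall>i\<in>{1..n}. convex_on (Rd d) (f i) \<and> f i \<in> C1L d L" "strongly_convex d \<mu> F"
      "is_arg_min F (\<lambda>x. x \<in> Rd d) xs" "x0 \<in> Rd d"
      "\<forall>i\<in>{1..n}. \<eta> 1 i = (2 * \<alpha> / \<mu>) / (k0 + real i)"
      "\<forall>k\<in>{2..K}. \<forall>i\<in>{1..n}. \<eta> k i = (2 * \<alpha> / \<mu>) / (k0 + real n * real k)"
      "bounded_iterates d n f \<eta> x0 S" "G = grad_bound d n f S x0"
  interpret shuffle_run n d K L \<mu> \<alpha> \<kappa> k0 G f \<eta> x0 xs S
    by unfold_locales (use as in \<open>auto simp: F\<close>)
  define c1 where "c1 = L / 2 * (20971520 * (\<alpha> ^ 3 * \<kappa> ^ 4 * (G\<^sup>2 / L\<^sup>2)))"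
  define c2 where "c2 = L * ((130 * k0) powr \<alpha>)"
  define C where "C = L / 2 * (20971520 * (\<alpha> ^ 3 * (G\<^sup>2 / L\<^sup>2))) + L * (130 * \<alpha>) powr \<alpha>"
  have "c1 = L / 2 * (20971520 * (\<alpha> ^ 3 * (G\<^sup>2 / L\<^sup>2))) * \<kappa> ^ 4" by (simp add: c1_def)
  also have "\<dots> \<le> C * \<kappa> ^ 4"
    using as kappa_ge_1 unfolding C_def by (intro mult_right_mono) auto
  finally have 1: "c1 \<le> C * \<kappa> ^ 4" .
  have "(130 * k0) powr \<alpha> = (130 * \<alpha>) powr \<alpha> * \<kappa> powr \<alpha>"
    using as kappa_ge_1 by (simp flip: powr_mult add: mult.assoc)
  then have "c2 = L * (130 * \<alpha>) powr \<alpha> * \<kappa> powr \<alpha>" by (simp add: c2_def)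
  also have "\<dots> \<le> C * \<kappa> powr \<alpha>"
    using as unfolding C_def by (intro mult_right_mono) auto
  finally have 2: "c2 \<le> C * \<kappa> powr \<alpha>" .
  show "\<exists>c\<^sub>1 c\<^sub>2. c\<^sub>1 \<le> (L / 2 * (20971520 * (\<alpha> ^ 3 * (G\<^sup>2 / L\<^sup>2))) + L * (130 * \<alpha>) powr \<alpha>) * \<kappa> ^ 4 \<and>
      c\<^sub>2 \<le> (L / 2 * (20971520 * (\<alpha> ^ 3 * (G\<^sup>2 / L\<^sup>2))) + L * (130 * \<alpha>) powr \<alpha>) * \<kappa> powr \<alpha> \<and>
      measure_pmf.expectation (random_shuffles n K)
          (\<lambda>\<sigma>. F (shuffle_iterate d n f \<eta> \<sigma> x0 (K + 1) 0)) - F xs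
        \<le> c\<^sub>1 * real n / (k0 + real n * real K)\<^sup>2
          + c\<^sub>2 * (norm (x0 - xs))\<^sup>2 / (k0 + real n * real K) powr \<alpha>"
    unfolding C_def[symmetric] F using 1 2 expectation_bound[OF K] unfolding c1_def c2_def by blast
qed

end
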